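(* Let $\varphi:\mathbb H\to\mathbb H$ be holomorphic. If the composition operator $C_\varphi$ is bounded on $H^2(\mathbb H)$, then its spectral radius is equal to its operator norm.
   Context: $\mathbb H=\{z\in\mathbb C:\Re z>0\}$ is the open right half-plane. $H^2(\mathbb H)$ is the Hilbert space of holomorphic functions $f$ on $\mathbb H$ with $\|f\|^2=\sup_{x>0}\frac{1}{2\pi}\int_{-\infty}^{\infty}|f(x+iy)|^2\,dy<\infty$. For a holomorphic map $\varphi:\mathbb H\to\mathbb H$, the composition operator is $C_\varphi f=f\circ\varphi$; it is bounded on $H^2(\mathbb H)$ if it maps $H^2(\mathbb H)$ into itself and is a bounded operator there. *)

theory Defs
  imports "HOL-Complex_Analysis.Complex_Analysis"
begin

definition RHP :: "complex set" where
  "RHP = {z. Re z > 0}"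

definition H2_norm_sq :: "(complex \<Rightarrow> complex) \<Rightarrow> ennreal" where
  "H2_norm_sq f =
     (SUP x\<in>{0::real<..}. ennreal (1 / (2 * pi)) *
        (\<integral>\<^sup>+ y. ennreal ((cmod (f (Complex x y)))\<^sup>2) \<partial>lborel))"

(* Functions on the half-plane are represented by total functions that are 0 outside it,
   so that equality in the space is equality of functions. *)
definition H2 :: "(complex \<Rightarrow> complex) set" where
  "H2 = {f. f holomorphic_on RHP \<and> (\<forall>z. z \<notin> RHP \<longrightarrow> f z = 0) \<and> H2_norm_sq f < \<infinity>}"

definition H2_norm :: "(complex \<Rightarrow> complex) \<Rightarrow> real" where
  "H2_norm f = sqrt (enn2real (H2_norm_sq f))"

definition H2_bounded_operator :: "((complex \<Rightarrow> complex) \<Rightarrow> complex \<Rightarrow> complex) \<Rightarrow> bool" where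
  "H2_bounded_operator T \<longleftrightarrow>
     (\<forall>f\<in>H2. T f \<in> H2) \<and>
     (\<forall>f\<in>H2. \<forall>g\<in>H2. T (\<lambda>z. f z + g z) = (\<lambda>z. T f z + T g z)) \<and>
     (\<forall>f\<in>H2. \<forall>c. T (\<lambda>z. c * f z) = (\<lambda>z. c * T f z)) \<and>
     (\<exists>M. \<forall>f\<in>H2. H2_norm (T f) \<le> M * H2_norm f)"

(* The real suprema in this definition and in the spectral radius below are meaningful for
   bounded operators only. *)
definition H2_operator_norm :: "((complex \<Rightarrow> complex) \<Rightarrow> complex \<Rightarrow> complex) \<Rightarrow> real" where
  "H2_operator_norm T = (SUP f\<in>{f \<in> H2. H2_norm f \<le> 1}. H2_norm (T f))"

definition H2_spectrum :: "((complex \<Rightarrow> complex) \<Rightarrow> complex \<Rightarrow> complex) \<Rightarrow> complex set" where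
  "H2_spectrum T =
     {\<mu>. \<not> (\<exists>S. H2_bounded_operator S \<and>
             (\<forall>f\<in>H2. S (\<lambda>z. T f z - \<mu> * f z) = f) \<and>
             (\<forall>f\<in>H2. (\<lambda>z. T (S f) z - \<mu> * S f z) = f))}"

definition H2_spectral_radius :: "((complex \<Rightarrow> complex) \<Rightarrow> complex \<Rightarrow> complex) \<Rightarrow> real" where
  "H2_spectral_radius T = (SUP \<mu>\<in>H2_spectrum T. cmod \<mu>)"

definition composition_operator ::
    "(complex \<Rightarrow> complex) \<Rightarrow> (complex \<Rightarrow> complex) \<Rightarrow> complex \<Rightarrow> complex" where
  "composition_operator \<phi> f = (\<lambda>z. if z \<in> RHP then f (\<phi> z) else 0)"

end

(* Boundedness forces c = inf Re (phi z) / Re z > 0, by testing the operator against reproducing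
   kernels. Upper bound: |f|^2 is dominated by the Poisson integral of its values on a vertical
   line, and integrating the Poisson kernel along the image under phi of another vertical line gives
   at most 1/c, hence norm(C_phi) <= c^(-1/2). Lower bound: c is the angular derivative of phi at
   infinity, so the n-th iterate satisfies Re (phi^n x) / x -> c^n as x -> infinity. If the spectrum
   lay in a disc of radius s, then Cauchy's estimates for the resolvent would bound the point
   evaluations of f o phi^n by C r^n norm(f) / sqrt (Re z) for every r > s; on kernels this gives
   1 <= 2 C^2 (c r^2)^n for all n, so s >= c^(-1/2). *)

theory Submission
  imports Defs
begin

section \<open>The norm of the Hardy space\<close>

text \<open>Three inequalities close a circle: \<open>c\<close>^(-1/2) <= spectral radius <=
  operator norm <= \<open>c\<close>^(-1/2), the middle one being the Neumann series. Only the last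
  has to be sharp. The first runs through point evaluations with crude constants, which disappear
  because the estimate holds for every iterate. What must not be lost is the factor
  \<open>c\<close>^n: the infimum of Re (\<phi>^n z) / Re z could exceed it if the points nearly
  attaining the infimum for \<phi> were moved elsewhere by \<phi>. The way out is that the infimum
  is also the limit of the quotient along the real axis, and that \<phi> keeps sequences asymptotic
  to this axis, so that the limits multiply. Everything is done with the values f z: pointwise sums
  and limits replace completeness and vector-valued holomorphy, interior vertical lines replace
  boundary values, and the bound on point evaluations translates norms into values.\<close>

definition line_sq :: "real \<Rightarrow> (complex \<Rightarrow> complex) \<Rightarrow> ennreal" where
  "line_sq x f = (\<integral>\<^sup>+ y. ennreal ((cmod (f (Complex x y)))\<^sup>2) \<partial>lborel)"

lemma open_RHP: "open RHP"
  unfolding RHP_def by (rule open_halfspace_Re_gt)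

lemma convex_RHP: "convex RHP"
  unfolding RHP_def by (rule convex_halfspace_Re_gt)

lemma RHP_iff: "z \<in> RHP \<longleftrightarrow> Re z > 0"
  by (simp add: RHP_def)

lemma H2_holomorphic: "f \<in> H2 \<Longrightarrow> f holomorphic_on RHP"
  by (simp add: H2_def)

lemma H2_outside: "f \<in> H2 \<Longrightarrow> z \<notin> RHP \<Longrightarrow> f z = 0"
  by (simp add: H2_def)

text \<open>Extension by 0 makes f the indicator of an open set times a function continuous there.
  Measurability on the whole plane is what the exchanges of integrals below require.\<close>

lemma H2_measurable:
  assumes "f \<in> H2" shows "f \<in> borel_measurable borel"
proof -
  have "(\<lambda>z. indicator RHP z *\<^sub>R f z) \<in> borel_measurable borel"
    using assms open_RHP
    by (intro borel_measurable_continuous_on_indicator holomorphic_on_imp_continuous_on H2_holomorphic) auto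
  also have "(\<lambda>z. indicator RHP z *\<^sub>R f z) = f"
    using H2_outside[OF assms] by (auto simp: indicator_def)
  finally show ?thesis .
qed

lemma Complex_measurable [measurable]:
  assumes "f \<in> borel_measurable M" "g \<in> borel_measurable M"
  shows "(\<lambda>x. Complex (f x) (g x)) \<in> borel_measurable M"
  using assms unfolding Complex_eq by measurable

lemma H2_norm_nonneg: "H2_norm f \<ge> 0"
  by (simp add: H2_norm_def)

lemma H2_norm_sq_eq: "f \<in> H2 \<Longrightarrow> H2_norm_sq f = ennreal ((H2_norm f)\<^sup>2)"
  by (simp add: H2_def H2_norm_def)

lemma line_sq_le:
  assumes "f \<in> H2" "x > 0"
  shows "line_sq x f \<le> ennreal (2 * pi * (H2_norm f)\<^sup>2)"
proof -
  have "ennreal (1 / (2 * pi)) * line_sq x f \<le> ennreal ((H2_norm f)\<^sup>2)"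
    unfolding H2_norm_sq_eq[OF assms(1), symmetric] H2_norm_sq_def line_sq_def
    using assms(2) by (intro SUP_upper) auto
  then have "ennreal (2 * pi) * (ennreal (1 / (2 * pi)) * line_sq x f) \<le> ennreal (2 * pi) * ennreal ((H2_norm f)\<^sup>2)"
    by (rule mult_left_mono) simp
  then show ?thesis
    by (simp add: mult.assoc[symmetric] ennreal_mult'[symmetric])
qed

text \<open>The working test for membership: later estimates are made on one vertical line at a
  time, and a bound uniform in x passes to the supremum. Nonnegativity of B lets the square root be
  taken.\<close>

lemma H2I:
  assumes "f holomorphic_on RHP" "\<And>z. z \<notin> RHP \<Longrightarrow> f z = 0" "B \<ge> 0"
    and "\<And>x. x > 0 \<Longrightarrow> line_sq x f \<le> ennreal (2 * pi * B\<^sup>2)"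
  shows "f \<in> H2" "H2_norm f \<le> B"
proof -
  have "ennreal (1 / (2 * pi)) * line_sq x f \<le> ennreal (B\<^sup>2)" if "x > 0" for x
  proof -
    have "ennreal (1 / (2 * pi)) * line_sq x f \<le> ennreal (1 / (2 * pi)) * ennreal (2 * pi * B\<^sup>2)"
      by (intro mult_left_mono assms that) auto
    also have "\<dots> = ennreal (B\<^sup>2)"
      by (simp add: ennreal_mult'[symmetric])
    finally show ?thesis .
  qed
  then have le: "H2_norm_sq f \<le> ennreal (B\<^sup>2)"
    unfolding H2_norm_sq_def line_sq_def by (intro SUP_least) auto
  then show "f \<in> H2"
    using assms(1,2) by (auto simp: H2_def intro: le_less_trans)
  have "enn2real (H2_norm_sq f) \<le> B\<^sup>2"
    using le by (metis enn2real_leI zero_le_power2)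
  then show "H2_norm f \<le> B"
    unfolding H2_norm_def using assms(3) real_le_lsqrt by simp
qed

lemma H2_zero: "(\<lambda>_. 0) \<in> H2" "H2_norm (\<lambda>_. 0) = 0"
  using H2I[of "\<lambda>_. 0" 0] H2_norm_nonneg[of "\<lambda>_. 0"] by (auto simp: line_sq_def)

lemma line_sq_cmult:
  assumes [measurable]: "f \<in> borel_measurable borel"
  shows "line_sq x (\<lambda>z. c * f z) = ennreal ((cmod c)\<^sup>2) * line_sq x f"
  unfolding line_sq_def
  by (subst nn_integral_cmult[symmetric])
     (auto simp: norm_mult power_mult_distrib ennreal_mult')

lemma H2_cmult_le:
  assumes "f \<in> H2"
  shows "(\<lambda>z. c * f z) \<in> H2" "H2_norm (\<lambda>z. c * f z) \<le> cmod c * H2_norm f"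
proof -
  have "line_sq x (\<lambda>z. c * f z) \<le> ennreal (2 * pi * (cmod c * H2_norm f)\<^sup>2)" if "x > 0" for x
  proof -
    have "line_sq x (\<lambda>z. c * f z) \<le> ennreal ((cmod c)\<^sup>2) * ennreal (2 * pi * (H2_norm f)\<^sup>2)"
      unfolding line_sq_cmult[OF H2_measurable[OF assms]]
      by (intro mult_left_mono line_sq_le assms that) auto
    also have "\<dots> = ennreal (2 * pi * (cmod c * H2_norm f)\<^sup>2)"
      by (simp add: ennreal_mult'[symmetric] power_mult_distrib mult_ac)
    finally show ?thesis .
  qed
  moreover have "(\<lambda>z. c * f z) holomorphic_on RHP"
    by (intro holomorphic_intros H2_holomorphic assms)
  ultimately show "(\<lambda>z. c * f z) \<in> H2" "H2_norm (\<lambda>z. c * f z) \<le> cmod c * H2_norm f"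
    using H2I[of "\<lambda>z. c * f z" "cmod c * H2_norm f"] assms H2_norm_nonneg[of f]
    by (auto simp: H2_outside)
qed

lemma H2_norm_cmult:
  assumes "f \<in> H2"
  shows "H2_norm (\<lambda>z. c * f z) = cmod c * H2_norm f"
proof (cases "c = 0")
  case False
  \<comment> \<open>The upper bound of \<open>H2_cmult_le\<close>, applied to c f and the inverse
    scalar, is the reverse inequality.\<close>
  have "H2_norm (\<lambda>z. inverse c * (c * f z)) \<le> cmod (inverse c) * H2_norm (\<lambda>z. c * f z)"
    by (intro H2_cmult_le assms)
  then have "H2_norm f \<le> H2_norm (\<lambda>z. c * f z) / cmod c"
    using False by (simp add: mult.assoc[symmetric] norm_inverse divide_inverse mult.commute)
  then have "cmod c * H2_norm f \<le> H2_norm (\<lambda>z. c * f z)"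
    using False by (simp add: field_simps)
  then show ?thesis using H2_cmult_le(2)[OF assms, of c] by linarith
qed (simp add: H2_zero)

text \<open>Minkowski's inequality, by integrating
  \<open>|u + v|\<^sup>2 \<le> (1 + b / a) |u|\<^sup>2 + (1 + a / b) |v|\<^sup>2\<close> with \<open>a\<close>, \<open>b\<close> decreasing to the two norms.\<close>

lemma norm_add_sq_le:
  fixes u v :: complex
  assumes "a > 0" "b > 0"
  shows "(cmod (u + v))\<^sup>2 \<le> (1 + b / a) * (cmod u)\<^sup>2 + (1 + a / b) * (cmod v)\<^sup>2"
proof -
  have "(cmod (u + v))\<^sup>2 \<le> (cmod u + cmod v)\<^sup>2"
    by (intro power_mono norm_triangle_ineq) auto
  moreover have "0 \<le> (b * cmod u - a * cmod v)\<^sup>2 / (a * b)"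
    using assms by auto
  then have "2 * cmod u * cmod v \<le> (b / a) * (cmod u)\<^sup>2 + (a / b) * (cmod v)\<^sup>2"
    using assms by (simp add: power2_eq_square field_simps)
  ultimately show ?thesis
    by (simp add: power2_sum algebra_simps)
qed

lemma H2_add_aux:
  assumes f: "f \<in> H2" and g: "g \<in> H2" and a: "a > H2_norm f" and b: "b > H2_norm g"
  shows "(\<lambda>z. f z + g z) \<in> H2" "H2_norm (\<lambda>z. f z + g z) \<le> a + b"
proof -
  \<comment> \<open>Strictness keeps both numbers positive even when a norm is 0, so that the
    weights b / a and a / b make sense.\<close>
  have pos: "a > 0" "b > 0"
    using a b H2_norm_nonneg[of f] H2_norm_nonneg[of g] by linarith+
  note [measurable] = H2_measurable[OF f] H2_measurable[OF g]
  have "line_sq x (\<lambda>z. f z + g z) \<le> ennreal (2 * pi * (a + b)\<^sup>2)" if "x > 0" for x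
  proof -
    have "line_sq x (\<lambda>z. f z + g z) \<le>
        (\<integral>\<^sup>+ y. ennreal (1 + b / a) * ennreal ((cmod (f (Complex x y)))\<^sup>2) +
             ennreal (1 + a / b) * ennreal ((cmod (g (Complex x y)))\<^sup>2) \<partial>lborel)"
      unfolding line_sq_def using norm_add_sq_le[OF pos] pos
      by (intro nn_integral_mono) (simp add: ennreal_mult'[symmetric] ennreal_plus[symmetric] del: ennreal_plus)
    also have "\<dots> = ennreal (1 + b / a) * line_sq x f + ennreal (1 + a / b) * line_sq x g"
      unfolding line_sq_def by (simp add: nn_integral_add nn_integral_cmult)
    also have "\<dots> \<le> ennreal (1 + b / a) * ennreal (2 * pi * a\<^sup>2) + ennreal (1 + a / b) * ennreal (2 * pi * b\<^sup>2)"
      using a b H2_norm_nonneg[of f] H2_norm_nonneg[of g]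
      by (intro add_mono mult_left_mono order_trans[OF line_sq_le] ennreal_leI power_mono mult_left_mono f g that) auto
    also have "\<dots> = ennreal ((1 + b / a) * (2 * pi * a\<^sup>2) + (1 + a / b) * (2 * pi * b\<^sup>2))"
      using pos by (simp add: ennreal_mult'[symmetric] ennreal_plus[symmetric] del: ennreal_plus)
    \<comment> \<open>The weights were chosen to make this sum a perfect square; the triangle
      inequality comes from here.\<close>
    also have "(1 + b / a) * (2 * pi * a\<^sup>2) + (1 + a / b) * (2 * pi * b\<^sup>2) = 2 * pi * (a + b)\<^sup>2"
      using pos by (simp add: field_simps power2_eq_square)
    finally show ?thesis .
  qed
  moreover have "(\<lambda>z. f z + g z) holomorphic_on RHP"
    by (intro holomorphic_intros H2_holomorphic f g)
  ultimately show "(\<lambda>z. f z + g z) \<in> H2" "H2_norm (\<lambda>z. f z + g z) \<le> a + b"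
    using H2I[of "\<lambda>z. f z + g z" "a + b"] f g pos
    by (auto simp: H2_outside)
qed

lemma H2_add:
  assumes "f \<in> H2" "g \<in> H2"
  shows "(\<lambda>z. f z + g z) \<in> H2"
  using H2_add_aux[OF assms, of "H2_norm f + 1" "H2_norm g + 1"] by simp

lemma H2_norm_triangle:
  assumes "f \<in> H2" "g \<in> H2"
  shows "H2_norm (\<lambda>z. f z + g z) \<le> H2_norm f + H2_norm g"
proof (rule field_le_epsilon)
  fix e :: real assume "e > 0"
  then show "H2_norm (\<lambda>z. f z + g z) \<le> H2_norm f + H2_norm g + e"
    using H2_add_aux(2)[OF assms, of "H2_norm f + e/2" "H2_norm g + e/2"] by simp
qed

lemma H2_cmult: "f \<in> H2 \<Longrightarrow> (\<lambda>z. c * f z) \<in> H2"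
  by (rule H2_cmult_le)

lemma H2_minus: "f \<in> H2 \<Longrightarrow> (\<lambda>z. - f z) \<in> H2"
  using H2_cmult[of f "-1"] by simp

lemma H2_norm_minus: "f \<in> H2 \<Longrightarrow> H2_norm (\<lambda>z. - f z) = H2_norm f"
  using H2_norm_cmult[of f "-1"] by simp

lemma H2_diff: "f \<in> H2 \<Longrightarrow> g \<in> H2 \<Longrightarrow> (\<lambda>z. f z - g z) \<in> H2"
  using H2_add[of f "\<lambda>z. - g z"] H2_minus by simp

lemma H2_norm_triangle_diff:
  "f \<in> H2 \<Longrightarrow> g \<in> H2 \<Longrightarrow> H2_norm (\<lambda>z. f z - g z) \<le> H2_norm f + H2_norm g"
  using H2_norm_triangle[of f "\<lambda>z. - g z"] H2_minus H2_norm_minus by simp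

section \<open>Cauchy's formula on rectangles\<close>

text \<open>The horizontal counterpart of \<open>contour_integral_linepath_same_Re\<close>: the
  affine substitution cancels the length of the segment.\<close>

lemma contour_integral_linepath_same_Im:
  assumes "Im z = c" "Im z' = c" "Re z = a" "Re z' = b" "a < b"
  shows   "contour_integral (linepath z z') f = integral {a..b} (\<lambda>x. f (Complex x c))"
proof -
  have zz': "z = Complex a c" "z' = Complex b c"
    using assms by (auto simp: complex_eq_iff)
  have "contour_integral (linepath z z') f =
         (z' - z) * integral {0..1} (\<lambda>x. f (linepath z z' x))"
    by (simp add: contour_integral_integral)
  also have "z' - z = of_real (b - a)"
    by (simp add: zz' Complex_eq)
  also have "integral {0..1} (\<lambda>x. f (linepath z z' x)) =
             integral {0..1} (\<lambda>x. f (Complex (linepath a b x) c))"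
    by (simp add: linepath_def Complex_eq scaleR_conv_of_real algebra_simps zz')
  also have "\<dots> = integral {0..(b - a) / (b - a)} (\<lambda>x. f (Complex (a + (b - a) * x) c))"
    using \<open>a < b\<close> by (simp add: algebra_simps linepath_def)
  also have "{0..(b - a) / (b - a)} = (\<lambda>x. x / (b - a)) ` {0..b - a}"
    using \<open>a < b\<close> by simp
  also have "integral \<dots> (\<lambda>x. f (Complex (a + (b - a) * x) c)) =
             integral {a-a..b-a} (\<lambda>x. f (Complex (x + a) c)) / of_real (b - a)"
    using \<open>a < b\<close> by (subst integral_stretch_real) (auto simp: scaleR_conv_of_real add_ac)
  also have "\<dots> = integral {a..b} (\<lambda>x. f (Complex x c)) / of_real (b - a)"
    by (subst integral_shift_real_ivl) (rule refl)
  finally show ?thesis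
    using \<open>a < b\<close> by simp
qed

text \<open>The signs come from the orientation: the top and left sides are run backwards, and dz =
  i dt on the vertical ones.\<close>

lemma contour_integral_rectpath:
  assumes f: "continuous_on (path_image (rectpath (Complex p u) (Complex q v))) f"
    and less: "p < q" "u < v"
  shows "contour_integral (rectpath (Complex p u) (Complex q v)) f =
    integral {p..q} (\<lambda>t. f (Complex t u)) + \<i> * integral {u..v} (\<lambda>t. f (Complex q t))
    - integral {p..q} (\<lambda>t. f (Complex t v)) - \<i> * integral {u..v} (\<lambda>t. f (Complex p t))"
proof -
  have sub: "closed_segment (Complex p u) (Complex q u) \<subseteq> path_image (rectpath (Complex p u) (Complex q v))"
     "closed_segment (Complex q u) (Complex q v) \<subseteq> path_image (rectpath (Complex p u) (Complex q v))"
     "closed_segment (Complex q v) (Complex p v) \<subseteq> path_image (rectpath (Complex p u) (Complex q v))"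
     "closed_segment (Complex p v) (Complex p u) \<subseteq> path_image (rectpath (Complex p u) (Complex q v))"
    by (auto simp: rectpath_def path_image_join Let_def)
  note cont = continuous_on_subset[OF f]
  have "contour_integral (rectpath (Complex p u) (Complex q v)) f =
      contour_integral (linepath (Complex p u) (Complex q u)) f +
      (contour_integral (linepath (Complex q u) (Complex q v)) f +
      (contour_integral (linepath (Complex q v) (Complex p v)) f +
       contour_integral (linepath (Complex p v) (Complex p u)) f))"
    unfolding rectpath_def Let_def
    using sub[THEN cont, THEN contour_integrable_continuous_linepath] by simp
  also have "contour_integral (linepath (Complex q v) (Complex p v)) f =
     - contour_integral (linepath (Complex p v) (Complex q v)) f"
    using sub by (intro contour_integral_reverse_linepath cont) auto
  also have "contour_integral (linepath (Complex p v) (Complex p u)) f =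
     - contour_integral (linepath (Complex p u) (Complex p v)) f"
    using sub by (intro contour_integral_reverse_linepath cont) auto
  finally show ?thesis
    using less by (simp add: contour_integral_linepath_same_Re contour_integral_linepath_same_Im)
qed

lemma Cauchy_rectpath:
  assumes S: "convex S" "open S" and f: "f holomorphic_on S"
    and sub: "cbox (Complex p u) (Complex q v) \<subseteq> S"
    and w: "p < Re w" "Re w < q" "u < Im w" "Im w < v"
  shows "((\<lambda>z. f z / (z - w)) has_contour_integral 2 * pi * \<i> * f w) (rectpath (Complex p u) (Complex q v))"
proof -
  have wb: "w \<in> box (Complex p u) (Complex q v)"
    using w by (simp add: in_box_complex_iff)
  have img: "path_image (rectpath (Complex p u) (Complex q v)) =
      cbox (Complex p u) (Complex q v) - box (Complex p u) (Complex q v)"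
    using w by (intro path_image_rectpath_cbox_minus_box) auto
  have "((\<lambda>z. f z / (z - w)) has_contour_integral
      2 * pi * \<i> * winding_number (rectpath (Complex p u) (Complex q v)) w * f w)
      (rectpath (Complex p u) (Complex q v))"
  proof (rule Cauchy_integral_formula_convex_simple[OF S(1) f])
    show "w \<in> interior S"
      using wb sub box_subset_cbox S(2) by (auto simp: interior_open)
    show "path_image (rectpath (Complex p u) (Complex q v)) \<subseteq> S - {w}"
      using img wb sub by auto
  qed auto
  then show ?thesis
    using winding_number_rectpath[OF wb] by simp
qed

lemma Complex_continuous [continuous_intros]:
  assumes "continuous_on S f" "continuous_on S g"
  shows "continuous_on S (\<lambda>x. Complex (f x) (g x))"
  unfolding Complex_eq by (intro continuous_intros assms)

lemma cmod_ge_Re_dist: "r \<le> \<bar>Re z - Re w\<bar> \<Longrightarrow> r \<le> cmod (z - w)"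
  using abs_Re_le_cmod[of "z - w"] by simp

lemma cmod_ge_Im_dist: "r \<le> \<bar>Im z - Im w\<bar> \<Longrightarrow> r \<le> cmod (z - w)"
  using abs_Im_le_cmod[of "z - w"] by simp

lemma norm_integral_div_le:
  fixes g :: "real \<Rightarrow> complex"
  assumes g: "continuous_on {a..b} g" and h: "continuous_on {a..b} h"
    and r: "0 < r" "\<And>t. t \<in> {a..b} \<Longrightarrow> r \<le> cmod (h t)"
  shows "cmod (integral {a..b} (\<lambda>t. g t / h t)) \<le> integral {a..b} (\<lambda>t. cmod (g t)) / r"
proof -
  have nz: "h t \<noteq> 0" if "t \<in> {a..b}" for t
    using r(1) r(2)[OF that] by auto
  have "cmod (integral {a..b} (\<lambda>t. g t / h t)) \<le> integral {a..b} (\<lambda>t. cmod (g t) / r)"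
  proof (rule integral_norm_bound_integral)
    show "(\<lambda>t. g t / h t) integrable_on {a..b}" "(\<lambda>t. cmod (g t) / r) integrable_on {a..b}"
      using nz r(1) by (auto intro!: integrable_continuous_interval continuous_intros g h)
    show "cmod (g t / h t) \<le> cmod (g t) / r" if "t \<in> {a..b}" for t
      using r(1) r(2)[OF that] by (auto simp: norm_divide intro!: divide_left_mono mult_pos_pos)
  qed
  then show ?thesis by simp
qed

text \<open>Every side has distance at least r from w, so the Cauchy kernel is at most 1 / r on the
  boundary. Applied to f^2, the sides become integrals of |f|^2, which the norm can control.\<close>

lemma Cauchy_rectangle_bound:
  assumes S: "convex S" "open S" and f: "f holomorphic_on S"
    and sub: "cbox (Complex p u) (Complex q v) \<subseteq> S"
    and r: "r > 0" "p + r \<le> Re w" "Re w + r \<le> q" "u + r \<le> Im w" "Im w + r \<le> v"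
  shows "2 * pi * r * cmod (f w) \<le>
    integral {p..q} (\<lambda>t. cmod (f (Complex t u))) + integral {u..v} (\<lambda>t. cmod (f (Complex q t)))
    + integral {p..q} (\<lambda>t. cmod (f (Complex t v))) + integral {u..v} (\<lambda>t. cmod (f (Complex p t)))"
    (is "_ \<le> ?I1 + ?I2 + ?I3 + ?I4")
proof -
  let ?R = "rectpath (Complex p u) (Complex q v)"
  have less: "p < Re w" "Re w < q" "u < Im w" "Im w < v" using r by auto
  then have pq: "p < q" "u < v" by auto
  have contf: "continuous_on S f"
    using f by (rule holomorphic_on_imp_continuous_on)
  have wb: "w \<in> box (Complex p u) (Complex q v)"
    using less by (simp add: in_box_complex_iff)
  have img: "path_image ?R = cbox (Complex p u) (Complex q v) - box (Complex p u) (Complex q v)"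
    using less by (intro path_image_rectpath_cbox_minus_box) auto
  have bounds:
    "cmod (integral {p..q} (\<lambda>t. f (Complex t u) / (Complex t u - w))) \<le> ?I1 / r"
    "cmod (integral {u..v} (\<lambda>t. f (Complex q t) / (Complex q t - w))) \<le> ?I2 / r"
    "cmod (integral {p..q} (\<lambda>t. f (Complex t v) / (Complex t v - w))) \<le> ?I3 / r"
    "cmod (integral {u..v} (\<lambda>t. f (Complex p t) / (Complex p t - w))) \<le> ?I4 / r"
  proof -
    have c: "continuous_on {p..q} (\<lambda>t. f (Complex t u))" "continuous_on {u..v} (\<lambda>t. f (Complex q t))"
      "continuous_on {p..q} (\<lambda>t. f (Complex t v))" "continuous_on {u..v} (\<lambda>t. f (Complex p t))"
      using sub pq by (auto simp: in_cbox_complex_iff subset_iff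
          intro!: continuous_on_compose2[OF contf] continuous_intros)
    have d: "continuous_on {p..q} (\<lambda>t. Complex t u - w)" "continuous_on {u..v} (\<lambda>t. Complex q t - w)"
      "continuous_on {p..q} (\<lambda>t. Complex t v - w)" "continuous_on {u..v} (\<lambda>t. Complex p t - w)"
      by (intro continuous_intros)+
    have e: "r \<le> cmod (Complex t u - w)" "r \<le> cmod (Complex t v - w)"
      "r \<le> cmod (Complex p t - w)" "r \<le> cmod (Complex q t - w)" for t
      using r by (simp_all add: cmod_ge_Re_dist cmod_ge_Im_dist)
    show "cmod (integral {p..q} (\<lambda>t. f (Complex t u) / (Complex t u - w))) \<le> ?I1 / r"
      by (rule norm_integral_div_le[OF c(1) d(1) r(1) e(1)])
    show "cmod (integral {u..v} (\<lambda>t. f (Complex q t) / (Complex q t - w))) \<le> ?I2 / r"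
      by (rule norm_integral_div_le[OF c(2) d(2) r(1) e(4)])
    show "cmod (integral {p..q} (\<lambda>t. f (Complex t v) / (Complex t v - w))) \<le> ?I3 / r"
      by (rule norm_integral_div_le[OF c(3) d(3) r(1) e(2)])
    show "cmod (integral {u..v} (\<lambda>t. f (Complex p t) / (Complex p t - w))) \<le> ?I4 / r"
      by (rule norm_integral_div_le[OF c(4) d(4) r(1) e(3)])
  qed
  define J1 J2 J3 J4 where "J1 = integral {p..q} (\<lambda>t. f (Complex t u) / (Complex t u - w))"
    and "J2 = integral {u..v} (\<lambda>t. f (Complex q t) / (Complex q t - w))"
    and "J3 = integral {p..q} (\<lambda>t. f (Complex t v) / (Complex t v - w))"
    and "J4 = integral {u..v} (\<lambda>t. f (Complex p t) / (Complex p t - w))"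
  have "contour_integral ?R (\<lambda>z. f z / (z - w)) = J1 + \<i> * J2 - J3 - \<i> * J4"
    unfolding J1_def J2_def J3_def J4_def
  proof (rule contour_integral_rectpath[OF _ pq])
    show "continuous_on (path_image ?R) (\<lambda>z. f z / (z - w))"
      using img sub wb by (intro continuous_intros continuous_on_subset[OF contf]) auto
  qed
  then have eq: "2 * pi * \<i> * f w = J1 + \<i> * J2 - J3 - \<i> * J4"
    using contour_integral_unique[OF Cauchy_rectpath[OF S f sub less]] by simp
  have "2 * pi * cmod (f w) = cmod (J1 + \<i> * J2 - J3 - \<i> * J4)"
    unfolding eq[symmetric] by (simp add: norm_mult)
  also have "\<dots> \<le> cmod J1 + cmod J2 + cmod J3 + cmod J4"
    using norm_triangle_ineq4[of "J1 + \<i> * J2 - J3" "\<i> * J4"]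
      norm_triangle_ineq4[of "J1 + \<i> * J2" J3] norm_triangle_ineq[of J1 "\<i> * J2"]
    by (simp add: norm_mult)
  finally have "2 * pi * cmod (f w) \<le> ?I1 / r + ?I2 / r + ?I3 / r + ?I4 / r"
    using bounds[folded J1_def J2_def J3_def J4_def] by linarith
  then show ?thesis
    using r(1) by (simp add: field_simps)
qed

lemma ennreal_integral:
  fixes g :: "real \<Rightarrow> real"
  assumes g: "continuous_on {a..b} g" and nonneg: "\<And>t. 0 \<le> g t"
  shows "ennreal (integral {a..b} g) = (\<integral>\<^sup>+ t. ennreal (g t) * indicator {a..b} t \<partial>lborel)"
  using nonneg
  by (intro nn_integral_has_integral_lebesgue'[symmetric] integrable_integral integrable_continuous_interval g) auto

lemma ennreal_integral_le:
  fixes g :: "real \<Rightarrow> real"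
  assumes g: "continuous_on {a..b} g" and nonneg: "\<And>t. 0 \<le> g t"
  shows "ennreal (integral {a..b} g) \<le> (\<integral>\<^sup>+ t. ennreal (g t) \<partial>lborel)"
  unfolding ennreal_integral[OF assms] by (intro nn_integral_mono) (auto simp: indicator_def)

section \<open>Point evaluations and the Poisson formula\<close>

text \<open>The norm is defined by vertical lines and does not directly control a single horizontal
  segment. Integrated over all heights, such segments are controlled, since exchanging the integrals
  turns them into vertical lines.\<close>

lemma H2_strip_integral_le:
  assumes f: "f \<in> H2" and p: "0 < p" "p \<le> q"
  shows "(\<integral>\<^sup>+ u. (\<integral>\<^sup>+ t. ennreal ((cmod (f (Complex t u)))\<^sup>2) * indicator {p..q} t \<partial>lborel) \<partial>lborel)
    \<le> ennreal ((q - p) * (2 * pi * (H2_norm f)\<^sup>2))"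
proof -
  note [measurable] = H2_measurable[OF f]
  have "(\<integral>\<^sup>+ u. (\<integral>\<^sup>+ t. ennreal ((cmod (f (Complex t u)))\<^sup>2) * indicator {p..q} t \<partial>lborel) \<partial>lborel) =
      (\<integral>\<^sup>+ t. (\<integral>\<^sup>+ u. ennreal ((cmod (f (Complex t u)))\<^sup>2) * indicator {p..q} t \<partial>lborel) \<partial>lborel)"
    by (rule lborel_pair.Fubini') measurable
  also have "\<dots> = (\<integral>\<^sup>+ t. line_sq t f * indicator {p..q} t \<partial>lborel)"
    unfolding line_sq_def by (intro nn_integral_cong nn_integral_multc) measurable
  also have "\<dots> \<le> (\<integral>\<^sup>+ t. ennreal (2 * pi * (H2_norm f)\<^sup>2) * indicator {p..q} t \<partial>lborel)"
    using line_sq_le[OF f] p by (intro nn_integral_mono) (auto simp: indicator_def)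
  also have "\<dots> = ennreal ((q - p) * (2 * pi * (H2_norm f)\<^sup>2))"
    using p by (subst nn_integral_cmult_indicator) (auto simp: ennreal_mult'[symmetric] mult.commute)
  finally show ?thesis .
qed

text \<open>Cauchy's formula for \<open>f\<^sup>2\<close> on rectangles of fixed width, averaged over their height, so
  that the horizontal sides sweep out a strip.\<close>

lemma H2_point_evaluation:
  assumes f: "f \<in> H2" and z: "z \<in> RHP"
  shows "cmod (f z) \<le> 4 * H2_norm f / sqrt (Re z)"
proof -
  note fm [measurable] = H2_measurable[OF f]
  \<comment> \<open>Half the distance to the boundary: the vertical sides have abscissas Re z / 2
    and 3 Re z / 2, both inside the half-plane.\<close>
  define a where "a = Re z / 2"
  have a: "a > 0" using z by (simp add: a_def RHP_iff)
  define p q y where "p = Re z - a" and "q = Re z + a" and "y = Im z"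
  have pq: "0 < p" "p < q" "q - p = 2 * a" using a by (auto simp: p_def q_def a_def)
  define c where "c = 2 * pi * a * (cmod (f z))\<^sup>2"
  define N where "N = 2 * pi * (H2_norm f)\<^sup>2"
  have N: "N \<ge> 0" by (simp add: N_def)
  \<comment> \<open>The contribution of a horizontal side at height u, bounded only on
    average.\<close>
  define H where "H u = (\<integral>\<^sup>+ t. ennreal ((cmod (f (Complex t u)))\<^sup>2) * indicator {p..q} t \<partial>lborel)" for u
  have Hm [measurable]: "H \<in> borel_measurable borel"
    unfolding H_def by measurable
  have H_int: "(\<integral>\<^sup>+ u. H u \<partial>lborel) \<le> ennreal (2 * a * N)"
    unfolding H_def N_def using H2_strip_integral_le[OF f, of p q] pq by simp
  have contf: "continuous_on RHP f"
    by (intro holomorphic_on_imp_continuous_on H2_holomorphic f)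
  have c_le: "ennreal c \<le> H (y + s) + H (y + (- 1) * s) + ennreal (2 * N)" if s: "a \<le> s" for s
  proof -
    let ?g = "\<lambda>z. (cmod (f z))\<^sup>2"
    have sub: "cbox (Complex p (y - s)) (Complex q (y + s)) \<subseteq> RHP"
      using pq by (auto simp: in_cbox_complex_iff RHP_iff)
    have cont: "continuous_on {p..q} (\<lambda>t. ?g (Complex t u))" "continuous_on {u..v} (\<lambda>t. ?g (Complex p t))"
       "continuous_on {u..v} (\<lambda>t. ?g (Complex q t))" for u v
      using pq by (auto intro!: continuous_intros continuous_on_compose2[OF contf] simp: RHP_iff)
    have hol: "(\<lambda>z. (f z)\<^sup>2) holomorphic_on RHP"
      by (intro holomorphic_intros H2_holomorphic f)
    have "c \<le> integral {p..q} (\<lambda>t. ?g (Complex t (y - s))) + integral {y - s..y + s} (\<lambda>t. ?g (Complex q t))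
      + integral {p..q} (\<lambda>t. ?g (Complex t (y + s))) + integral {y - s..y + s} (\<lambda>t. ?g (Complex p t))"
      using Cauchy_rectangle_bound[OF convex_RHP open_RHP hol sub a, of z] s
      by (simp add: c_def p_def q_def y_def norm_power)
    then have "ennreal c \<le> ennreal (integral {p..q} (\<lambda>t. ?g (Complex t (y - s))))
      + ennreal (integral {y - s..y + s} (\<lambda>t. ?g (Complex q t)))
      + ennreal (integral {p..q} (\<lambda>t. ?g (Complex t (y + s))))
      + ennreal (integral {y - s..y + s} (\<lambda>t. ?g (Complex p t)))"
      by (subst ennreal_plus[symmetric] | simp add: ennreal_leI integral_nonneg
          integrable_continuous_interval cont del: ennreal_plus)+
    also have "\<dots> \<le> H (y - s) + line_sq q f + H (y + s) + line_sq p f"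
      unfolding H_def line_sq_def
      by (intro add_mono ennreal_integral_le cont eq_refl[OF ennreal_integral]) auto
    also have "\<dots> \<le> H (y - s) + ennreal N + H (y + s) + ennreal N"
      unfolding N_def using pq by (intro add_mono line_sq_le f order_refl) auto
    also have "\<dots> = H (y + s) + H (y + (- 1) * s) + ennreal (2 * N)"
      using N by (simp add: ac_simps mult_2 flip: ennreal_plus)
    finally show ?thesis .
  qed
  \<comment> \<open>Averaging over the half-height s in [a, 2 a], an interval of length a. Each
    horizontal side sweeps part of a strip of width 2 a and contributes at most 2 a N; the vertical
    sides contribute 2 N for each s. Starting at s = a keeps the horizontal sides at distance a from
    z.\<close>
  have "ennreal (a * c) = (\<integral>\<^sup>+ s. ennreal c * indicator {a..2*a} s \<partial>lborel)"
    using a by (subst nn_integral_cmult_indicator) (auto simp: ennreal_mult'[symmetric] mult.commute)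
  also have "\<dots> \<le> (\<integral>\<^sup>+ s. H (y + 1 * s) + H (y + (- 1) * s) + ennreal (2 * N) * indicator {a..2*a} s \<partial>lborel)"
    using c_le by (intro nn_integral_mono) (auto simp: indicator_def)
  also have "\<dots> = (\<integral>\<^sup>+ s. H (y + 1 * s) \<partial>lborel) + (\<integral>\<^sup>+ s. H (y + (- 1) * s) \<partial>lborel) + ennreal (2 * N * a)"
    using a N by (simp add: nn_integral_add nn_integral_cmult_indicator ennreal_mult'[symmetric])
  also have "(\<integral>\<^sup>+ s. H (y + 1 * s) \<partial>lborel) = (\<integral>\<^sup>+ u. H u \<partial>lborel)"
    using nn_integral_real_affine[OF Hm, of 1 y] by simp
  also have "(\<integral>\<^sup>+ s. H (y + (- 1) * s) \<partial>lborel) = (\<integral>\<^sup>+ u. H u \<partial>lborel)"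
    using nn_integral_real_affine[OF Hm, of "-1" y] by simp
  also have "(\<integral>\<^sup>+ u. H u \<partial>lborel) + (\<integral>\<^sup>+ u. H u \<partial>lborel) + ennreal (2 * N * a)
      \<le> ennreal (2 * a * N) + ennreal (2 * a * N) + ennreal (2 * N * a)"
    by (intro add_mono H_int order_refl)
  also have "\<dots> = ennreal (6 * a * N)"
    using N a by (simp flip: ennreal_plus)
  finally have "a * c \<le> 6 * a * N"
    using N a by (subst (asm) ennreal_le_iff) auto
  then have "c \<le> 6 * N"
    using a by simp
  \<comment> \<open>Since c is pi Re z |f z|^2 and N is 2 pi times the squared norm, c <= 6 N gives
    the factor 12. It is rounded up to 16 = 4^2.\<close>
  then have "(cmod (f z))\<^sup>2 \<le> 12 * (H2_norm f)\<^sup>2 / Re z"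
    using a by (simp add: c_def N_def a_def field_simps)
  also have "\<dots> \<le> (4 * H2_norm f / sqrt (Re z))\<^sup>2"
    using a by (auto simp: power_divide power_mult_distrib a_def intro!: divide_right_mono)
  finally show ?thesis
    by (rule power2_le_imp_le) (use a H2_norm_nonneg[of f] in \<open>auto simp: a_def\<close>)
qed

text \<open>Cauchy's formula at w minus Cauchy's theorem for the pole reflected in the imaginary
  axis, which lies outside the contour. The difference of the kernels decays quadratically, so the
  far sides vanish, and on the axis it is the Poisson kernel up to a factor. The margin \<eta> puts
  the axis inside the domain of holomorphy.\<close>

lemma Poisson_half_plane:
  fixes f :: "complex \<Rightarrow> complex"
  assumes \<eta>: "\<eta> > 0" and f: "f holomorphic_on {z. Re z > - \<eta>}"
    and B: "\<And>z. Re z \<ge> 0 \<Longrightarrow> cmod (f z) \<le> B" and w: "Re w > 0"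
  shows "((\<lambda>Y. integral {-Y..Y} (\<lambda>t. of_real (Re w / (cmod (w - Complex 0 t))\<^sup>2) * f (Complex 0 t)))
    \<longlongrightarrow> pi * f w) at_top"
proof -
  \<comment> \<open>A convex open set that contains the closed half-plane but omits the reflected
    pole \<open>- cnj w\<close>.\<close>
  define S where "S = {z. Re z > - min \<eta> (Re w)}"
  have S: "convex S" "open S" unfolding S_def
    by (auto intro: convex_halfspace_Re_gt open_halfspace_Re_gt)
  have nz: "z + cnj w \<noteq> 0" if "z \<in> S" for z
  proof
    assume "z + cnj w = 0"
    then have "Re (z + cnj w) = 0" by (simp only: zero_complex.simps)
    then have "Re z + Re w = 0" by simp
    then show False using that by (auto simp: S_def)
  qed
  have fS: "f holomorphic_on S"
    by (rule holomorphic_on_subset[OF f]) (auto simp: S_def)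
  have contf: "continuous_on S f"
    using fS by (rule holomorphic_on_imp_continuous_on)
  have B0: "B \<ge> 0" using B[of 0] norm_ge_zero[of "f 0"] by (simp del: norm_ge_zero)
  define I where "I Y = integral {-Y..Y} (\<lambda>t. of_real (Re w / (cmod (w - Complex 0 t))\<^sup>2) * f (Complex 0 t))" for Y
  define G where "G z = f z / (z - w) - f z / (z + cnj w)" for z
  have G_eq: "G z = f z * of_real (2 * Re w) / ((z - w) * (z + cnj w))" if "z \<in> S" "z \<noteq> w" for z
  proof -
    have "of_real (2 * Re w) = w + cnj w" by (simp add: complex_add_cnj)
    then show ?thesis using nz[OF that(1)] that(2)
      by (simp add: G_def field_simps)
  qed
  \<comment> \<open>The far sides have total length 4 Y, and \<open>G\<close> is at most 8 B Re w /
    Y^2 on them. Halving, because the axis contributes -2 \<open>I Y\<close>, gives 16.\<close>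
  have bound: "cmod (I Y - pi * f w) \<le> (16 * B * Re w) / Y" if Y: "Y > 2 * cmod w" for Y
  proof -
    have Y0: "Y > 0" using Y norm_ge_zero[of w] by linarith
    have wY: "Re w < Y" "- Y < Im w" "Im w < Y"
      using Y Y0 abs_Re_le_cmod[of w] abs_Im_le_cmod[of w] by auto
    let ?R = "rectpath (Complex 0 (- Y)) (Complex Y Y)"
    have sub: "cbox (Complex 0 (- Y)) (Complex Y Y) \<subseteq> S"
      using \<eta> w by (auto simp: in_cbox_complex_iff S_def)
    have wb: "w \<in> box (Complex 0 (- Y)) (Complex Y Y)"
      using w wY by (simp add: in_box_complex_iff)
    have img: "path_image ?R = cbox (Complex 0 (- Y)) (Complex Y Y) - box (Complex 0 (- Y)) (Complex Y Y)"
      using Y0 by (intro path_image_rectpath_cbox_minus_box) auto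
    have c1: "continuous_on (path_image ?R) (\<lambda>z. f z / (z - w))"
      using img sub wb by (intro continuous_intros continuous_on_subset[OF contf]) auto
    have c2: "continuous_on (path_image ?R) (\<lambda>z. f z / (z + cnj w))"
      using img sub nz by (intro continuous_intros continuous_on_subset[OF contf]) auto
    have "((\<lambda>z. f z / (z + cnj w)) has_contour_integral 0) ?R"
      using S sub img nz by (intro Cauchy_theorem_convex_simple[of _ S] holomorphic_intros fS) auto
    moreover have "((\<lambda>z. f z / (z - w)) has_contour_integral 2 * pi * \<i> * f w) ?R"
      using w wY by (intro Cauchy_rectpath[OF S fS sub]) auto
    ultimately have "(G has_contour_integral 2 * pi * \<i> * f w - 0) ?R"
      unfolding G_def by (intro has_contour_integral_diff)
    then have i2: "contour_integral ?R G = 2 * pi * \<i> * f w"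
      using contour_integral_unique by force
    have contG: "continuous_on (path_image ?R) G"
      unfolding G_def by (intro continuous_on_diff c1 c2)
    define J1 J2 J3 J4 where "J1 = integral {0..Y} (\<lambda>t. G (Complex t (- Y)))"
      and "J2 = integral {- Y..Y} (\<lambda>t. G (Complex Y t))"
      and "J3 = integral {0..Y} (\<lambda>t. G (Complex t Y))"
      and "J4 = integral {- Y..Y} (\<lambda>t. G (Complex 0 t))"
    have eq: "2 * pi * \<i> * f w = J1 + \<i> * J2 - J3 - \<i> * J4"
      using contour_integral_rectpath[OF contG] Y0 i2
      unfolding J1_def J2_def J3_def J4_def by simp
    have J4: "J4 = - 2 * I Y"
    proof -
      have "G (Complex 0 t) = - 2 * (of_real (Re w / (cmod (w - Complex 0 t))\<^sup>2) * f (Complex 0 t))" for t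
      proof -
        have ne: "Complex 0 t \<noteq> w" using w by auto
        have "Complex 0 t + cnj w = cnj (w - Complex 0 t)" by (simp add: complex_eq_iff)
        then have "(Complex 0 t - w) * (Complex 0 t + cnj w) = - of_real ((cmod (w - Complex 0 t))\<^sup>2)"
          by (metis complex_norm_square minus_diff_eq mult_minus_left of_real_power)
        moreover have "Complex 0 t \<in> S" using w \<eta> by (simp add: S_def)
        ultimately show ?thesis using ne by (simp add: G_eq)
      qed
      then show ?thesis unfolding J4_def I_def by (simp only: integral_mult_right)
    qed
    have Gb: "cmod (G z) \<le> 8 * B * Re w / Y\<^sup>2" if "Re z \<ge> 0" "Y \<le> cmod z" for z
    proof -
      have "cmod (z - w) \<ge> Y / 2" "cmod (z + cnj w) \<ge> Y / 2"
        using norm_triangle_ineq2[of z w] norm_triangle_ineq2[of z "- cnj w"] that Y by auto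
      then have *: "(Y / 2) * (Y / 2) \<le> cmod (z - w) * cmod (z + cnj w)"
        using Y0 by (intro mult_mono) auto
      have "z \<in> S" "z \<noteq> w" using that \<eta> w Y Y0 by (auto simp: S_def)
      then have "cmod (G z) = cmod (f z) * (2 * Re w) / (cmod (z - w) * cmod (z + cnj w))"
        using w by (simp add: G_eq norm_mult norm_divide)
      also have "\<dots> \<le> B * (2 * Re w) / ((Y / 2) * (Y / 2))"
        using * Y0 w B0 by (intro frac_le mult_right_mono B that mult_nonneg_nonneg) auto
      also have "\<dots> = 8 * B * Re w / Y\<^sup>2"
        by (simp add: power2_eq_square)
      finally show ?thesis .
    qed
    have ImReY: "Y \<le> cmod (Complex t Y)" "Y \<le> cmod (Complex t (- Y))" "Y \<le> cmod (Complex Y t)" for t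
      using Y0 abs_Im_le_cmod[of "Complex t Y"] abs_Im_le_cmod[of "Complex t (- Y)"]
        abs_Re_le_cmod[of "Complex Y t"] by auto
    have contGS: "continuous_on A (\<lambda>t. G (h t))" if "continuous_on A h" "\<And>t. t \<in> A \<Longrightarrow> h t \<in> path_image ?R" for A :: "real set" and h
      using that by (auto intro: continuous_on_compose2[OF contG])
    define K where "K = 8 * B * Re w / Y\<^sup>2"
    note Gb = Gb[folded K_def]
    have "cmod J1 \<le> K * (Y - 0)" unfolding J1_def
      using Y0 by (intro integral_bound contGS Gb ImReY continuous_intros)
        (auto simp: path_image_rectpath)
    moreover have "cmod J3 \<le> K * (Y - 0)" unfolding J3_def
      using Y0 by (intro integral_bound contGS Gb ImReY continuous_intros)
        (auto simp: path_image_rectpath)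
    moreover have "cmod J2 \<le> K * (Y - (- Y))" unfolding J2_def
      using Y0 by (intro integral_bound contGS Gb ImReY continuous_intros)
        (auto simp: path_image_rectpath)
    moreover have "2 * cmod (I Y - pi * f w) = cmod (J1 + \<i> * J2 - J3)"
    proof -
      have "2 * \<i> * (I Y - pi * f w) = - (J1 + \<i> * J2 - J3)"
        using eq J4 by (simp add: algebra_simps)
      then have "cmod (2 * \<i> * (I Y - pi * f w)) = cmod (J1 + \<i> * J2 - J3)"
        by (metis norm_minus_cancel)
      then show ?thesis by (simp add: norm_mult)
    qed
    moreover have "cmod (J1 + \<i> * J2 - J3) \<le> cmod J1 + cmod J2 + cmod J3"
      using norm_triangle_ineq4[of "J1 + \<i> * J2" J3] norm_triangle_ineq[of J1 "\<i> * J2"]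
      by (simp add: norm_mult)
    ultimately have "2 * cmod (I Y - pi * f w) \<le> K * (4 * Y)"
      by (simp add: algebra_simps)
    then show ?thesis using Y0 by (simp add: K_def power2_eq_square)
  qed
  have "((\<lambda>Y. I Y - pi * f w) \<longlongrightarrow> 0) at_top"
  proof (rule Lim_null_comparison)
    show "\<forall>\<^sub>F Y in at_top. norm (I Y - pi * f w) \<le> (16 * B * Re w) / Y"
      using eventually_gt_at_top[of "2 * cmod w"] by eventually_elim (rule bound)
    show "((\<lambda>Y. (16 * B * Re w) / Y) \<longlongrightarrow> 0) at_top"
      by (rule real_tendsto_divide_at_top[OF tendsto_const filterlim_ident])
  qed
  then show ?thesis
    unfolding I_def[symmetric] by (simp add: LIM_zero_iff)
qed

section \<open>The upper bound for composition operators\<close>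

text \<open>With z replaced by a difference of points, this exhibits the Poisson kernel as the real
  part of a holomorphic function, a property that survives substituting \<phi>.\<close>

lemma Re_divide_one: "Re (1 / z) = Re z / (cmod z)\<^sup>2"
  by (simp add: Re_divide cmod_power2)

text \<open>The Poisson formula for f^2, shifted to the line Re z = e. To the right of that line
  point evaluations bound f uniformly, so the formula applies without boundary values; absolute
  values under the integral give the majorant.\<close>

lemma H2_Poisson_majorant:
  assumes f: "f \<in> H2" and e: "e > 0" and w: "Re w > e"
  shows "ennreal ((cmod (f w))\<^sup>2) \<le>
    (\<integral>\<^sup>+ t. ennreal (Re (1 / (w - Complex e t)) / pi) * ennreal ((cmod (f (Complex e t)))\<^sup>2) \<partial>lborel)"
    (is "_ \<le> ?R")
proof -
  define F where "F z = (f (z + of_real e))\<^sup>2" for z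
  define K where "K t = Re (1 / (w - Complex e t))" for t
  have K: "K t = (Re w - e) / (cmod (w - Complex e t))\<^sup>2" for t
    unfolding K_def Re_divide_one by simp
  have ne: "w \<noteq> Complex e t" for t using w by auto
  have shift: "Complex 0 t + of_real e = Complex e t" "w - of_real e - Complex 0 t = w - Complex e t" for t
    by (simp_all add: complex_eq_iff)
  have contf: "continuous_on RHP f"
    by (intro holomorphic_on_imp_continuous_on H2_holomorphic f)
  have F: "F holomorphic_on {z. Re z > - e}"
    unfolding F_def
    by (intro holomorphic_intros holomorphic_on_compose_gen[OF _ H2_holomorphic[OF f], unfolded o_def])
       (auto simp: RHP_iff)
  have Fb: "cmod (F z) \<le> (4 * H2_norm f / sqrt e)\<^sup>2" if "Re z \<ge> 0" for z
  proof -
    have "cmod (f (z + of_real e)) \<le> 4 * H2_norm f / sqrt (Re (z + of_real e))"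
      using that e by (intro H2_point_evaluation f) (auto simp: RHP_iff)
    also have "\<dots> \<le> 4 * H2_norm f / sqrt e"
      using that e H2_norm_nonneg[of f] by (intro divide_left_mono mult_pos_pos) auto
    finally show ?thesis
      unfolding F_def norm_power by (rule power_mono) simp
  qed
  define I where "I Y = integral {-Y..Y} (\<lambda>t. of_real (K t) * F (Complex 0 t))" for Y
  have lim: "(I \<longlongrightarrow> pi * F (w - of_real e)) at_top"
    using Poisson_half_plane[OF e F Fb, of "w - of_real e"] w unfolding I_def K shift by simp
  have "F (w - of_real e) = (f w)\<^sup>2" by (simp add: F_def)
  with lim have lim: "((\<lambda>Y. ennreal (cmod (I Y) / pi)) \<longlongrightarrow> ennreal ((cmod (f w))\<^sup>2)) at_top"
    by (auto intro!: tendsto_eq_intros simp: norm_mult norm_power)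
  have bound: "ennreal (cmod (I Y) / pi) \<le> ?R" for Y
  proof -
    have K0: "K t \<ge> 0" for t using w by (simp add: K)
    have contK: "continuous_on S K" for S
      unfolding K using ne by (intro continuous_intros) auto
    have contfe: "continuous_on S (\<lambda>t. f (Complex e t))" for S
      using e by (intro continuous_on_compose2[OF contf] continuous_intros) (auto simp: RHP_iff)
    have FC: "F (Complex 0 t) = (f (Complex e t))\<^sup>2" for t
      by (simp add: F_def shift)
    have "cmod (I Y) \<le> integral {-Y..Y} (\<lambda>t. K t * (cmod (f (Complex e t)))\<^sup>2)"
      unfolding I_def FC
    proof (rule integral_norm_bound_integral)
      show "(\<lambda>t. complex_of_real (K t) * (f (Complex e t))\<^sup>2) integrable_on {- Y..Y}"
        by (intro integrable_continuous_interval continuous_intros contK contfe)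
      show "(\<lambda>t. K t * (cmod (f (Complex e t)))\<^sup>2) integrable_on {- Y..Y}"
        by (intro integrable_continuous_interval continuous_intros contK contfe)
    qed (use K0 in \<open>auto simp: norm_mult norm_power\<close>)
    then have "cmod (I Y) / pi \<le> integral {-Y..Y} (\<lambda>t. K t / pi * (cmod (f (Complex e t)))\<^sup>2)"
      by (simp add: divide_right_mono)
    then have "ennreal (cmod (I Y) / pi) \<le> ennreal (integral {-Y..Y} (\<lambda>t. K t / pi * (cmod (f (Complex e t)))\<^sup>2))"
      by (rule ennreal_leI)
    also have "\<dots> \<le> (\<integral>\<^sup>+ t. ennreal (K t / pi * (cmod (f (Complex e t)))\<^sup>2) \<partial>lborel)"
      using K0 by (intro ennreal_integral_le continuous_intros contK contfe) auto
    also have "\<dots> = ?R"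
      unfolding K_def[symmetric] by (intro nn_integral_cong ennreal_mult'') simp
    finally show ?thesis .
  qed
  show ?thesis
    by (rule tendsto_upperbound[OF lim]) (auto simp: bound)
qed

text \<open>Weighting by the Poisson kernel of a point \<open>r\<close> of the real axis and letting
  \<open>r\<close> tend to infinity.\<close>

lemma Re_integral_vertical_line_le:
  fixes q :: "complex \<Rightarrow> complex"
  assumes q: "q holomorphic_on RHP" and q0: "\<And>z. z \<in> RHP \<Longrightarrow> Re (q z) \<ge> 0"
    and qb: "\<And>z. z \<in> RHP \<Longrightarrow> cmod (q z) \<le> A / Re z" and x: "x > 0"
  shows "(\<integral>\<^sup>+ y. ennreal (Re (q (Complex x y))) \<partial>lborel) \<le> ennreal (pi * A)"
proof -
  have A0: "A \<ge> 0"
    using qb[of 1] norm_ge_zero[of "q 1"] by (simp add: RHP_iff del: norm_ge_zero)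
  define F where "F z = q (z + of_real x)" for z
  define u where "u y = Re (q (Complex x y))" for y
  have shift: "Complex 0 t + of_real x = Complex x t" for t
    by (simp add: complex_eq_iff)
  have contq: "continuous_on RHP q"
    using q by (rule holomorphic_on_imp_continuous_on)
  have contqx: "continuous_on S (\<lambda>y. q (Complex x y))" for S
    using x by (intro continuous_on_compose2[OF contq] continuous_intros) (auto simp: RHP_iff)
  have contu: "continuous_on S u" for S
    unfolding u_def by (intro continuous_intros contqx)
  have u0: "u y \<ge> 0" for y
    unfolding u_def using x by (intro q0) (simp add: RHP_iff)
  have F: "F holomorphic_on {z. Re z > - x}"
    unfolding F_def
    by (intro holomorphic_intros holomorphic_on_compose_gen[OF _ q, unfolded o_def])
       (auto simp: RHP_iff)
  have Fb: "cmod (F z) \<le> A / x" if "Re z \<ge> 0" for z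
  proof -
    have "cmod (F z) \<le> A / Re (z + of_real x)"
      unfolding F_def using that x by (intro qb) (auto simp: RHP_iff)
    also have "\<dots> \<le> A / x"
      using that x A0 by (intro divide_left_mono mult_pos_pos) auto
    finally show ?thesis .
  qed
  have bound_r: "integral {-Y..Y} u \<le> pi * A * (1 + (Y / r)\<^sup>2)" if r: "r > 0" for Y r
  proof -
    define K where "K t = r / (r\<^sup>2 + t\<^sup>2)" for t
    have K0: "K t \<ge> 0" for t using r by (simp add: K_def)
    have pos: "r\<^sup>2 + t\<^sup>2 > 0" for t using r by (simp add: add_pos_nonneg)
    have contK: "continuous_on S K" for S
      unfolding K_def using pos by (intro continuous_intros) (auto simp: less_imp_neq[symmetric])
    have int: "(\<lambda>t. K t * u t) integrable_on {a..b}" for a b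
      by (intro integrable_continuous_interval continuous_intros contK contu)
    have "((\<lambda>Z. integral {-Z..Z} (\<lambda>t. of_real (K t) * F (Complex 0 t))) \<longlongrightarrow> pi * F (of_real r)) at_top"
      using Poisson_half_plane[OF x F Fb, of "of_real r"] r by (simp add: K_def cmod_power2)
    then have "((\<lambda>Z. Re (integral {-Z..Z} (\<lambda>t. of_real (K t) * F (Complex 0 t)))) \<longlongrightarrow> Re (pi * F (of_real r))) at_top"
      by (rule tendsto_Re)
    moreover have "Re (integral {-Z..Z} (\<lambda>t. of_real (K t) * F (Complex 0 t))) = integral {-Z..Z} (\<lambda>t. K t * u t)" for Z
    proof -
      have "(\<lambda>t. of_real (K t) * F (Complex 0 t)) integrable_on {-Z..Z}"
        unfolding F_def shift
        by (intro integrable_continuous_interval continuous_intros contK contqx)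
      from integral_linear[OF this bounded_linear_Re] show ?thesis
        by (simp add: o_def u_def F_def shift)
    qed
    ultimately have lim: "((\<lambda>Z. integral {-Z..Z} (\<lambda>t. K t * u t)) \<longlongrightarrow> pi * Re (F (of_real r))) at_top"
      by simp
    have "integral {-Y..Y} (\<lambda>t. K t * u t) \<le> pi * Re (F (of_real r))"
    proof (rule tendsto_lowerbound[OF lim])
      show "\<forall>\<^sub>F Z in at_top. integral {-Y..Y} (\<lambda>t. K t * u t) \<le> integral {-Z..Z} (\<lambda>t. K t * u t)"
        using eventually_ge_at_top[of Y]
        by eventually_elim (auto intro!: integral_subset_le int mult_nonneg_nonneg K0 u0)
    qed simp
    also have "Re (F (of_real r)) \<le> A / r"
    proof -
      have "Re (F (of_real r)) \<le> cmod (F (of_real r))" by (rule complex_Re_le_cmod)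
      also have "\<dots> \<le> A / Re (of_real r + of_real x)"
        unfolding F_def using r x by (intro qb) (auto simp: RHP_iff)
      also have "\<dots> \<le> A / r"
        using r x A0 by (intro divide_left_mono mult_pos_pos) auto
      finally show ?thesis .
    qed
    finally have 1: "integral {-Y..Y} (\<lambda>t. K t * u t) \<le> pi * (A / r)"
      by simp
    \<comment> \<open>\<open>K\<close> decreases in |t|, so \<open>K Y\<close> is its least value on
      [-Y, Y]. Dividing by it produces the factor 1 / (r K Y) = 1 + (Y / r)^2.\<close>
    have "K Y * integral {-Y..Y} u = integral {-Y..Y} (\<lambda>t. K Y * u t)"
      by simp
    also have "\<dots> \<le> integral {-Y..Y} (\<lambda>t. K t * u t)"
    proof (rule integral_le)
      show "(\<lambda>t. K Y * u t) integrable_on {- Y..Y}"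
        by (intro integrable_continuous_interval continuous_intros contu)
      show "K Y * u t \<le> K t * u t" if "t \<in> {-Y..Y}" for t
      proof -
        have "t\<^sup>2 \<le> Y\<^sup>2" using that by (intro abs_le_square_iff[THEN iffD1]) auto
        then have "K Y \<le> K t" unfolding K_def
          using r pos by (intro divide_left_mono mult_pos_pos) auto
        then show ?thesis using u0 by (rule mult_right_mono)
      qed
    qed (rule int)
    finally have "K Y * integral {-Y..Y} u \<le> pi * A / r"
      using 1 by simp
    then show ?thesis
      using r pos[of Y] by (simp add: K_def field_simps power2_eq_square)
  qed
  have bound: "integral {-Y..Y} u \<le> pi * A" for Y
  proof (rule tendsto_lowerbound)
    show "((\<lambda>r. pi * A * (1 + (Y / r)\<^sup>2)) \<longlongrightarrow> pi * A) at_top"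
      by (rule tendsto_eq_intros real_tendsto_divide_at_top[OF tendsto_const filterlim_ident] refl | simp)+
    show "\<forall>\<^sub>F r in at_top. integral {-Y..Y} u \<le> pi * A * (1 + (Y / r)\<^sup>2)"
      using eventually_gt_at_top[of 0] by eventually_elim (rule bound_r)
  qed simp
  have um: "u \<in> borel_measurable borel"
    by (intro borel_measurable_continuous_onI contu)
  have "(\<integral>\<^sup>+ y. ennreal (u y) \<partial>lborel) =
      (\<integral>\<^sup>+ y. (SUP n. ennreal (u y) * indicator {- real n..real n} y) \<partial>lborel)"
  proof (rule nn_integral_cong)
    fix y :: real
    obtain n where n: "\<bar>y\<bar> \<le> real n" using real_arch_simple by blast
    show "ennreal (u y) = (SUP n. ennreal (u y) * indicator {- real n..real n} y)"
    proof (rule antisym)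
      show "ennreal (u y) \<le> (SUP n. ennreal (u y) * indicator {- real n..real n} y)"
        using n by (intro SUP_upper2[of n]) (auto simp: indicator_def)
      show "(SUP n. ennreal (u y) * indicator {- real n..real n} y) \<le> ennreal (u y)"
        by (intro SUP_least) (auto simp: indicator_def)
    qed
  qed
  also have "\<dots> = (SUP n. (\<integral>\<^sup>+ y. ennreal (u y) * indicator {- real n..real n} y \<partial>lborel))"
    using um by (intro nn_integral_monotone_convergence_SUP)
      (auto simp: incseq_def le_fun_def indicator_def)
  also have "\<dots> \<le> ennreal (pi * A)"
    using bound u0 by (intro SUP_least) (auto simp: ennreal_integral[symmetric] contu intro!: ennreal_leI)
  finally show ?thesis unfolding u_def .
qed

lemma line_sq_compose_le:
  assumes phi: "\<phi> holomorphic_on RHP" and c: "c > 0"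
    and ge: "\<And>z. z \<in> RHP \<Longrightarrow> c * Re z \<le> Re (\<phi> z)"
    and f: "f \<in> H2" and x: "x > 0"
  shows "line_sq x (\<lambda>z. f (\<phi> z)) \<le> ennreal (2 * pi * (H2_norm f)\<^sup>2 / c)"
proof -
  note fm [measurable] = H2_measurable[OF f]
  \<comment> \<open>Half of the lower bound c x for Re \<phi> on the line Re z = x. In
    \<open>q\<close> below, the shift by x / 2 raises that bound by exactly e, so c Re z is left
    after subtracting e; the other x / 2 is the line of integration.\<close>
  define e where "e = c * x / 2"
  have e: "e > 0" using c x by (simp add: e_def)
  define \<psi> where "\<psi> y = \<phi> (Complex x y)" for y
  have contphi: "continuous_on RHP \<phi>"
    using phi by (rule holomorphic_on_imp_continuous_on)
  have "continuous_on UNIV \<psi>"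
    unfolding \<psi>_def using x by (intro continuous_on_compose2[OF contphi] continuous_intros) (auto simp: RHP_iff)
  then have [measurable]: "\<psi> \<in> borel_measurable borel"
    by (rule borel_measurable_continuous_onI)
  define K where "K y t = Re (1 / (\<psi> y - Complex e t))" for y t
  \<comment> \<open>The bound is uniform in t: after the exchange of integrals, only the integral of
    |f|^2 over the line Re z = e remains.\<close>
  have K_int: "(\<integral>\<^sup>+ y. ennreal (K y t / pi) \<partial>lborel) \<le> ennreal (1 / c)" for t
  proof -
    define q where "q z = 1 / (\<phi> (z + of_real (x / 2)) - Complex e t)" for z
    have Re_ge: "Re (\<phi> (z + of_real (x / 2)) - Complex e t) \<ge> c * Re z" if "z \<in> RHP" for z
      using ge[of "z + of_real (x / 2)"] that x by (simp add: RHP_iff e_def algebra_simps)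
    have Re_pos: "Re (\<phi> (z + of_real (x / 2)) - Complex e t) > 0" if "z \<in> RHP" for z
    proof -
      have "0 < c * Re z" using c that by (simp add: RHP_iff)
      then show ?thesis using Re_ge[OF that] by linarith
    qed
    have ne: "\<phi> (z + of_real (x / 2)) - Complex e t \<noteq> 0" if "z \<in> RHP" for z
      using Re_pos[OF that] by (metis less_irrefl zero_complex.simps(1))
    have "(\<integral>\<^sup>+ y. ennreal (Re (q (Complex (x / 2) y))) \<partial>lborel) \<le> ennreal (pi * (1 / c))"
    proof (rule Re_integral_vertical_line_le)
      have "(\<lambda>z. \<phi> (z + of_real (x / 2))) holomorphic_on RHP"
        using x by (intro holomorphic_on_compose_gen[OF _ phi, unfolded o_def] holomorphic_intros)
          (auto simp: RHP_iff)
      then show "q holomorphic_on RHP"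
        unfolding q_def using ne by (intro holomorphic_intros) auto
      fix z assume z: "z \<in> RHP"
      show "Re (q z) \<ge> 0"
        unfolding q_def Re_divide_one using Re_pos[OF z] by simp
      have "c * Re z \<le> cmod (\<phi> (z + of_real (x / 2)) - Complex e t)"
        using Re_ge[OF z] complex_Re_le_cmod order_trans by blast
      then have "1 / cmod (\<phi> (z + of_real (x / 2)) - Complex e t) \<le> 1 / (c * Re z)"
        using c z ne[OF z] by (intro divide_left_mono mult_pos_pos) (simp_all add: RHP_iff del: of_real_divide)
      then show "cmod (q z) \<le> 1 / c / Re z"
        by (simp add: q_def norm_divide)
    qed (use x in auto)
    moreover have "Complex (x / 2) y + of_real (x / 2) = Complex x y" for y
      by (simp add: complex_eq_iff)
    ultimately have K': "(\<integral>\<^sup>+ y. ennreal (K y t) \<partial>lborel) \<le> ennreal (pi / c)"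
      by (simp add: q_def K_def \<psi>_def)
    have "(\<integral>\<^sup>+ y. ennreal (K y t / pi) \<partial>lborel) = ennreal (1 / pi) * (\<integral>\<^sup>+ y. ennreal (K y t) \<partial>lborel)"
      by (subst nn_integral_cmult[symmetric]) (auto simp: ennreal_mult'[symmetric] K_def)
    also have "\<dots> \<le> ennreal (1 / pi) * ennreal (pi / c)"
      by (intro mult_left_mono K') simp
    also have "\<dots> = ennreal (1 / c)"
      by (simp add: ennreal_mult'[symmetric])
    finally show ?thesis .
  qed
  have "line_sq x (\<lambda>z. f (\<phi> z)) \<le>
      (\<integral>\<^sup>+ y. (\<integral>\<^sup>+ t. ennreal (K y t / pi) * ennreal ((cmod (f (Complex e t)))\<^sup>2) \<partial>lborel) \<partial>lborel)"
    unfolding line_sq_def K_def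
  proof (rule nn_integral_mono)
    fix y :: real
    have "Re (\<psi> y) \<ge> c * x"
      unfolding \<psi>_def using ge[of "Complex x y"] x by (simp add: RHP_iff)
    moreover have "c * x > e"
      using c x by (simp add: e_def)
    ultimately show "ennreal ((cmod (f (\<phi> (Complex x y))))\<^sup>2) \<le>
        (\<integral>\<^sup>+ t. ennreal (Re (1 / (\<psi> y - Complex e t)) / pi) * ennreal ((cmod (f (Complex e t)))\<^sup>2) \<partial>lborel)"
      using H2_Poisson_majorant[OF f e, of "\<psi> y"] unfolding \<psi>_def by linarith
  qed
  also have "\<dots> = (\<integral>\<^sup>+ t. (\<integral>\<^sup>+ y. ennreal (K y t / pi) * ennreal ((cmod (f (Complex e t)))\<^sup>2) \<partial>lborel) \<partial>lborel)"
    unfolding K_def by (rule lborel_pair.Fubini') measurable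
  also have "\<dots> = (\<integral>\<^sup>+ t. (\<integral>\<^sup>+ y. ennreal (K y t / pi) \<partial>lborel) * ennreal ((cmod (f (Complex e t)))\<^sup>2) \<partial>lborel)"
    unfolding K_def by (intro nn_integral_cong nn_integral_multc) measurable
  also have "\<dots> \<le> (\<integral>\<^sup>+ t. ennreal (1 / c) * ennreal ((cmod (f (Complex e t)))\<^sup>2) \<partial>lborel)"
    by (intro nn_integral_mono mult_right_mono K_int) simp
  also have "\<dots> = ennreal (1 / c) * line_sq e f"
    unfolding line_sq_def by (rule nn_integral_cmult) measurable
  also have "\<dots> \<le> ennreal (1 / c) * ennreal (2 * pi * (H2_norm f)\<^sup>2)"
    by (intro mult_left_mono line_sq_le f e) simp
  also have "\<dots> = ennreal (2 * pi * (H2_norm f)\<^sup>2 / c)"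
    using c by (simp add: ennreal_mult'[symmetric])
  finally show ?thesis .
qed

lemma H2_norm_composition_operator_le:
  assumes "\<phi> holomorphic_on RHP" "\<phi> ` RHP \<subseteq> RHP" and c: "c > 0"
    and "\<And>z. z \<in> RHP \<Longrightarrow> c * Re z \<le> Re (\<phi> z)" and f: "f \<in> H2"
  shows "H2_norm (composition_operator \<phi> f) \<le> H2_norm f / sqrt c"
proof (rule H2I(2))
  have "(\<lambda>z. f (\<phi> z)) holomorphic_on RHP"
    by (rule holomorphic_on_compose_gen[OF assms(1) H2_holomorphic[OF f] assms(2), unfolded o_def])
  then show "composition_operator \<phi> f holomorphic_on RHP"
    by (rule holomorphic_transform) (simp add: composition_operator_def)
  show "composition_operator \<phi> f z = 0" if "z \<notin> RHP" for z
    using that by (simp add: composition_operator_def)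
  show "H2_norm f / sqrt c \<ge> 0"
    using c H2_norm_nonneg[of f] by simp
  fix x :: real assume x: "x > 0"
  have "line_sq x (composition_operator \<phi> f) = line_sq x (\<lambda>z. f (\<phi> z))"
    using x by (simp add: line_sq_def composition_operator_def RHP_iff)
  also have "\<dots> \<le> ennreal (2 * pi * (H2_norm f)\<^sup>2 / c)"
    by (rule line_sq_compose_le[OF assms(1) c assms(4) f x])
  also have "2 * pi * (H2_norm f)\<^sup>2 / c = 2 * pi * (H2_norm f / sqrt c)\<^sup>2"
    using c by (simp add: power_divide)
  finally show "line_sq x (composition_operator \<phi> f) \<le> ennreal (2 * pi * (H2_norm f / sqrt c)\<^sup>2)" .
qed

section \<open>Kernel functions and the angular derivative at infinity\<close>

text \<open>This is the reproducing kernel at w for the present normalisation. On the line Re z = x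
  its squared modulus is its real part divided by x + Re w, so the integral bound for real parts
  applies with A = 1.\<close>

lemma H2_kernel:
  assumes w: "w \<in> RHP"
  defines "k \<equiv> \<lambda>z. if z \<in> RHP then 1 / (z + cnj w) else 0"
  shows "k \<in> H2" "H2_norm k \<le> 1 / sqrt (2 * Re w)"
proof -
  define q where "q z = 1 / (z + cnj w)" for z
  have Re_pos: "Re (z + cnj w) > 0" if "z \<in> RHP" for z
    using that w by (simp add: RHP_iff)
  have ne: "z + cnj w \<noteq> 0" if "z \<in> RHP" for z
    using Re_pos[OF that] by (metis less_irrefl zero_complex.simps(1))
  have q: "q holomorphic_on RHP"
    unfolding q_def using ne by (intro holomorphic_intros) auto
  have k: "k holomorphic_on RHP"
    using q by (rule holomorphic_transform) (simp add: k_def q_def)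
  have "line_sq x k \<le> ennreal (2 * pi * (1 / sqrt (2 * Re w))\<^sup>2)" if x: "x > 0" for x
  proof -
    have Rw: "Re w > 0" using w by (simp add: RHP_iff)
    have le: "(\<integral>\<^sup>+ y. ennreal (Re (q (Complex x y))) \<partial>lborel) \<le> ennreal (pi * 1)"
    proof (rule Re_integral_vertical_line_le[OF q _ _ x])
      fix z assume z: "z \<in> RHP"
      show "Re (q z) \<ge> 0"
        unfolding q_def Re_divide_one using Re_pos[OF z] by simp
      have "Re z \<le> cmod (z + cnj w)"
        using complex_Re_le_cmod[of "z + cnj w"] Rw by simp
      then show "cmod (q z) \<le> 1 / Re z"
        using z ne[OF z] by (auto simp: q_def norm_divide RHP_iff intro!: divide_left_mono mult_pos_pos)
    qed
    have cont: "continuous_on UNIV (\<lambda>y. Re (q (Complex x y)))"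
      using x by (intro continuous_intros continuous_on_compose2[OF holomorphic_on_imp_continuous_on[OF q]])
        (auto simp: RHP_iff)
    have eq: "(cmod (k (Complex x y)))\<^sup>2 = 1 / (x + Re w) * Re (q (Complex x y))" for y
      unfolding q_def Re_divide_one using x Rw
      by (simp add: k_def RHP_iff norm_divide power_divide)
    have "line_sq x k = (\<integral>\<^sup>+ y. ennreal (1 / (x + Re w)) * ennreal (Re (q (Complex x y))) \<partial>lborel)"
      unfolding line_sq_def eq using x Rw by (intro nn_integral_cong ennreal_mult') simp
    also have "\<dots> = ennreal (1 / (x + Re w)) * (\<integral>\<^sup>+ y. ennreal (Re (q (Complex x y))) \<partial>lborel)"
      using borel_measurable_continuous_onI[OF cont] by (intro nn_integral_cmult) auto
    also have "\<dots> \<le> ennreal (1 / Re w) * ennreal (pi * 1)"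
      using x Rw by (intro mult_mono le ennreal_leI divide_left_mono) auto
    also have "\<dots> = ennreal (2 * pi * (1 / sqrt (2 * Re w))\<^sup>2)"
      using Rw by (simp add: ennreal_mult'[symmetric] power_divide)
    finally show ?thesis .
  qed
  then show "k \<in> H2" "H2_norm k \<le> 1 / sqrt (2 * Re w)"
    using H2I[OF k, of "1 / sqrt (2 * Re w)"] w by (auto simp: k_def RHP_iff)
qed

text \<open>Tested on the kernel at w: its value there is 1 / (2 Re w), while its norm is at most
  the square root of that number.\<close>

lemma H2_evaluation_lower_bound:
  assumes w: "w \<in> RHP" and D: "\<And>f. f \<in> H2 \<Longrightarrow> cmod (f w) \<le> D * H2_norm f" "D \<ge> 0"
  shows "1 \<le> 2 * Re w * D\<^sup>2"
proof -
  define k where "k = (\<lambda>z. if z \<in> RHP then 1 / (z + cnj w) else 0)"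
  have Rw: "Re w > 0" using w by (simp add: RHP_iff)
  have "1 / (2 * Re w) = cmod (k w)"
    using w Rw by (simp add: k_def complex_add_cnj norm_divide)
  also have "\<dots> \<le> D * H2_norm k"
    using H2_kernel(1)[OF w] by (intro D) (simp add: k_def)
  also have "\<dots> \<le> D * (1 / sqrt (2 * Re w))"
    using H2_kernel(2)[OF w] D(2) by (intro mult_left_mono) (simp_all add: k_def)
  finally have "1 / (2 * Re w) \<le> D * (1 / sqrt (2 * Re w))" .
  then have "(1 / (2 * Re w))\<^sup>2 \<le> (D * (1 / sqrt (2 * Re w)))\<^sup>2"
    using Rw by (intro power_mono) auto
  then have "1 / (2 * Re w) * (1 / (2 * Re w)) \<le> D\<^sup>2 * (1 / (2 * Re w))"
    using Rw by (simp add: power_mult_distrib power_divide) (simp add: power2_eq_square)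
  then have "1 / (2 * Re w) \<le> D\<^sup>2"
    using Rw by (subst (asm) mult_le_cancel_right) auto
  then show ?thesis
    using Rw by (simp add: field_simps)
qed

section \<open>Schwarz-Pick and Harnack estimates on the half-plane\<close>

lemma norm_add_cnj_sq: "(cmod (p + cnj q))\<^sup>2 = (cmod (p - q))\<^sup>2 + 4 * Re p * Re q"
  unfolding cmod_power2 by (simp add: power2_eq_square algebra_simps)

text \<open>Schwarz's lemma, after z0 and its image have been moved to the centre of the unit disc
  by Cayley transforms.\<close>

lemma Schwarz_Pick_half_plane:
  assumes psi: "\<psi> holomorphic_on RHP" and im: "\<psi> ` RHP \<subseteq> RHP" and z: "z \<in> RHP" and z0: "z0 \<in> RHP"
  shows "cmod (\<psi> z - \<psi> z0) * cmod (z + cnj z0) \<le> cmod (z - z0) * cmod (\<psi> z + cnj (\<psi> z0))"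
proof -
  \<comment> \<open>The inverse of the Cayley transform z |-> (z - z0) / (z + cnj z0), which takes
    z0 to 0.\<close>
  define g where "g \<zeta> = (z0 + cnj z0 * \<zeta>) / (1 - \<zeta>)" for \<zeta>
  define p0 where "p0 = \<psi> z0"
  define m where "m p = (p - p0) / (p + cnj p0)" for p
  define F where "F \<zeta> = m (\<psi> (g \<zeta>))" for \<zeta>
  have p0: "p0 \<in> RHP" using im z0 by (auto simp: p0_def)
  have ne: "p + cnj q \<noteq> 0" if "p \<in> RHP" "q \<in> RHP" for p q
  proof
    assume "p + cnj q = 0"
    then have "Re (p + cnj q) = 0" by (simp only: zero_complex.simps)
    then show False using that by (simp add: RHP_iff)
  qed
  have lt: "cmod (p - q) < cmod (p + cnj q)" if "p \<in> RHP" "q \<in> RHP" for p q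
  proof (rule power2_less_imp_less)
    show "(cmod (p - q))\<^sup>2 < (cmod (p + cnj q))\<^sup>2"
      unfolding norm_add_cnj_sq using that by (simp add: RHP_iff)
  qed simp
  have g: "g \<zeta> \<in> RHP" if "cmod \<zeta> < 1" for \<zeta>
  proof -
    have "1 - \<zeta> \<noteq> 0" using that by auto
    then have "cmod (1 - \<zeta>) > 0" by simp
    moreover have "Re ((z0 + cnj z0 * \<zeta>) * cnj (1 - \<zeta>)) = Re z0 * (1 - (cmod \<zeta>)\<^sup>2)"
      unfolding cmod_power2 by (simp add: power2_eq_square algebra_simps)
    moreover have "(cmod \<zeta>)\<^sup>2 < 1"
      using that by (simp add: power_less_one_iff abs_square_less_1)
    ultimately show ?thesis
      using z0 by (simp add: RHP_iff g_def complex_div_cnj[of "z0 + cnj z0 * \<zeta>"] del: complex_cnj_diff)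
  qed
  define \<xi> where "\<xi> = (z - z0) / (z + cnj z0)"
  have xi: "cmod \<xi> < 1"
    using lt[OF z z0] ne[OF z z0] by (simp add: \<xi>_def norm_divide)
  have g_xi: "g \<xi> = z"
  proof -
    have n1: "z + cnj z0 \<noteq> 0" and n2: "z0 + cnj z0 \<noteq> 0" using ne z z0 by auto
    have "1 - \<xi> = (z0 + cnj z0) / (z + cnj z0)"
      using n1 by (simp add: \<xi>_def field_simps)
    moreover have "z0 + cnj z0 * \<xi> = z * (z0 + cnj z0) / (z + cnj z0)"
      using n1 by (simp add: \<xi>_def field_simps)
    ultimately show ?thesis using n1 n2 by (simp add: g_def)
  qed
  have "cmod (F \<xi>) \<le> cmod \<xi>"
  proof (rule Schwarz_Lemma(1)[OF _ _ _ xi])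
    have "g holomorphic_on ball 0 1"
      unfolding g_def by (intro holomorphic_intros) auto
    then have "(\<lambda>\<zeta>. \<psi> (g \<zeta>)) holomorphic_on ball 0 1"
      using g by (intro holomorphic_on_compose_gen[OF _ psi, unfolded o_def]) auto
    moreover have "\<psi> (g \<zeta>) + cnj p0 \<noteq> 0" if "cmod \<zeta> < 1" for \<zeta>
      using g[OF that] im p0 by (intro ne) auto
    ultimately show "F holomorphic_on ball 0 1"
      unfolding F_def m_def by (intro holomorphic_intros) auto
    show "F 0 = 0" by (simp add: F_def m_def g_def p0_def)
    show "cmod (F \<zeta>) < 1" if "cmod \<zeta> < 1" for \<zeta>
      using lt[of "\<psi> (g \<zeta>)" p0] ne[of "\<psi> (g \<zeta>)" p0] g[OF that] im p0
      by (auto simp: F_def m_def norm_divide)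
  qed
  then have "cmod (\<psi> z - \<psi> z0) / cmod (\<psi> z + cnj (\<psi> z0)) \<le> cmod (z - z0) / cmod (z + cnj z0)"
    unfolding F_def g_xi by (simp add: m_def p0_def \<xi>_def norm_divide)
  moreover have "cmod (\<psi> z + cnj (\<psi> z0)) > 0" "cmod (z + cnj z0) > 0"
    using ne z z0 im by auto
  ultimately show ?thesis
    by (simp add: field_simps)
qed

text \<open>In the notation of the proof, Schwarz-Pick gives
  \<open>d * D \<le> e * (d + 2 * P)\<close>, because \<open>\<psi> z + cnj (\<psi> z0)\<close> and
  \<open>\<psi> z - \<psi> z0\<close> differ by 2 P only. Solving for d uses D^2 - e^2 = 4 Re z Re
  z0. The point is the factor Re (\<psi> z0): a small real part at one point limits the increments
  everywhere.\<close>

lemma Harnack_half_plane: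
  assumes psi: "\<psi> holomorphic_on RHP" "\<psi> ` RHP \<subseteq> RHP" and z: "z \<in> RHP" and z0: "z0 \<in> RHP"
  shows "cmod (\<psi> z - \<psi> z0) \<le> Re (\<psi> z0) / Re z0 * ((cmod (z + cnj z0))\<^sup>2 / Re z)"
proof -
  define d where "d = cmod (\<psi> z - \<psi> z0)"
  define D where "D = cmod (z + cnj z0)"
  define e where "e = cmod (z - z0)"
  define P where "P = Re (\<psi> z0)"
  define m where "m = Re z * Re z0"
  have m: "m > 0" using z z0 by (simp add: m_def RHP_iff)
  have P: "P > 0" using imageI[OF z0, of \<psi>] psi(2) by (auto simp: P_def RHP_iff)
  have De: "D\<^sup>2 = e\<^sup>2 + 4 * m"
    unfolding D_def e_def m_def by (simp add: norm_add_cnj_sq)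
  have nonneg: "d \<ge> 0" "D \<ge> 0" "e \<ge> 0" by (simp_all add: d_def D_def e_def)
  have "e\<^sup>2 \<le> D\<^sup>2" using De m by simp
  then have eD: "e \<le> D" by (rule power2_le_imp_le) (rule nonneg)
  have "cmod (\<psi> z + cnj (\<psi> z0)) \<le> d + 2 * P"
  proof -
    have eq: "\<psi> z + cnj (\<psi> z0) = (\<psi> z - \<psi> z0) + of_real (2 * P)"
      by (simp add: complex_eq_iff P_def)
    have "cmod (\<psi> z + cnj (\<psi> z0)) \<le> cmod (\<psi> z - \<psi> z0) + cmod (of_real (2 * P))"
      unfolding eq by (rule norm_triangle_ineq)
    then show ?thesis using P by (simp add: d_def)
  qed
  then have "d * D \<le> e * (d + 2 * P)"
    using Schwarz_Pick_half_plane[OF psi z z0] nonneg mult_left_mono order_trans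
    unfolding d_def D_def e_def by blast
  then have "d * (D - e) \<le> 2 * e * P"
    by (simp add: algebra_simps)
  then have "d * (D - e) * (D + e) \<le> 2 * e * P * (D + e)"
    using nonneg by (intro mult_right_mono) auto
  also have "\<dots> \<le> 2 * D * P * (D + D)"
    using nonneg eD P by (intro mult_mono) auto
  also have "d * (D - e) * (D + e) = d * (4 * m)"
  proof -
    have "(D - e) * (D + e) = 4 * m"
      using De by (simp add: algebra_simps power2_eq_square)
    then show ?thesis by (simp add: mult.assoc)
  qed
  finally have "d * m \<le> P * D\<^sup>2"
    by (simp add: power2_eq_square mult_ac)
  then have "d \<le> P * D\<^sup>2 / m"
    using m by (simp add: field_simps)
  then show ?thesis
    by (simp add: d_def P_def D_def m_def mult.commute)
qed

text \<open>The limit along the real axis is the angular derivative at infinity (Julia--Caratheodory);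
  sequences asymptotic to the real axis are needed in order to iterate.\<close>

lemma angular_derivative_at_infinity:
  assumes phi: "\<phi> holomorphic_on RHP"
    and ge: "\<And>z. z \<in> RHP \<Longrightarrow> c * Re z \<le> Re (\<phi> z)"
    and inf: "\<And>\<epsilon>. \<epsilon> > 0 \<Longrightarrow> \<exists>z\<in>RHP. Re (\<phi> z) < (c + \<epsilon>) * Re z"
    and u: "\<And>k. u k \<in> RHP" and r: "filterlim r at_top sequentially"
    and lim: "(\<lambda>k. u k / of_real (r k)) \<longlonglongrightarrow> 1"
  shows "(\<lambda>k. \<phi> (u k) / of_real (r k)) \<longlonglongrightarrow> of_real c"
proof (rule tendstoI)
  fix \<delta> :: real assume "\<delta> > 0"
  \<comment> \<open>The three summands of the error bound \<open>h\<close> below tend to 2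
    \<epsilon>, 0 and \<epsilon>.\<close>
  define \<epsilon> where "\<epsilon> = \<delta> / 4"
  have \<epsilon>: "\<epsilon> > 0" using \<open>\<delta> > 0\<close> by (simp add: \<epsilon>_def)
  obtain z0 where z0: "z0 \<in> RHP" "Re (\<phi> z0) < (c + \<epsilon>) * Re z0"
    using inf[OF \<epsilon>] by blast
  \<comment> \<open>Subtracting slightly less than the linear part keeps the range in the open
    half-plane, while at z0 the quotient of real parts is at most 2 \<epsilon>. Harnack's estimate
    then makes the remainder of order \<epsilon> r.\<close>
  define \<psi> where "\<psi> z = \<phi> z - of_real (c - \<epsilon>) * z" for z
  have psi: "\<psi> holomorphic_on RHP"
    unfolding \<psi>_def by (intro holomorphic_intros phi)
  have im: "\<psi> ` RHP \<subseteq> RHP"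
  proof safe
    fix z assume z: "z \<in> RHP"
    then have "\<epsilon> * Re z > 0" using \<epsilon> by (simp add: RHP_iff)
    then show "\<psi> z \<in> RHP"
      using ge[OF z] by (simp add: \<psi>_def RHP_iff algebra_simps)
  qed
  have small: "Re (\<psi> z0) / Re z0 \<le> 2 * \<epsilon>"
    using z0 by (simp add: \<psi>_def RHP_iff field_simps)
  define h where "h k = 2 * \<epsilon> * ((cmod (u k / of_real (r k) + cnj z0 / of_real (r k)))\<^sup>2 / Re (u k / of_real (r k)))
      + cmod (\<psi> z0 / of_real (r k)) + cmod (of_real (c - \<epsilon>) * (u k / of_real (r k)) - of_real c)" for k
  have inv: "(\<lambda>k. a / complex_of_real (r k)) \<longlonglongrightarrow> 0" for a
    by (intro tendsto_divide_0[OF tendsto_const] filterlim_compose[OF filterlim_of_real_at_infinity r] | simp)+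
  have "h \<longlonglongrightarrow> 2 * \<epsilon> * ((cmod (1 + 0))\<^sup>2 / Re 1) + cmod 0 + cmod (of_real (c - \<epsilon>) * 1 - of_real c)"
    unfolding h_def by (intro tendsto_intros lim inv) simp
  also have "of_real (c - \<epsilon>) * 1 - of_real c = - complex_of_real \<epsilon>"
    by simp
  finally have "h \<longlonglongrightarrow> 3 * \<epsilon>"
    using \<epsilon> by simp
  moreover have "3 * \<epsilon> < \<delta>" using \<epsilon> by (simp add: \<epsilon>_def)
  ultimately have "\<forall>\<^sub>F k in sequentially. h k < \<delta>"
    by (rule order_tendstoD)
  moreover have "\<forall>\<^sub>F k in sequentially. r k > 0"
    using r by (simp add: filterlim_at_top_dense)
  ultimately show "\<forall>\<^sub>F k in sequentially. dist (\<phi> (u k) / of_real (r k)) (of_real c) < \<delta>"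
  proof eventually_elim
    case (elim k)
    let ?r = "complex_of_real (r k)"
    have rk: "r k > 0" by fact
    have uk: "Re (u k) > 0" using u[of k] by (simp add: RHP_iff)
    have "cmod (\<psi> (u k) - \<psi> z0) \<le> Re (\<psi> z0) / Re z0 * ((cmod (u k + cnj z0))\<^sup>2 / Re (u k))"
      by (rule Harnack_half_plane[OF psi im u z0(1)])
    also have "\<dots> \<le> 2 * \<epsilon> * ((cmod (u k + cnj z0))\<^sup>2 / Re (u k))"
      using uk by (intro mult_right_mono small) auto
    finally have "cmod (\<psi> (u k) - \<psi> z0) / r k \<le> 2 * \<epsilon> * ((cmod (u k + cnj z0))\<^sup>2 / Re (u k)) / r k"
      by (rule divide_right_mono) (use rk in simp)
    moreover have "cmod ((\<psi> (u k) - \<psi> z0) / ?r) = cmod (\<psi> (u k) - \<psi> z0) / r k"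
      using rk by (simp add: norm_divide)
    ultimately have "cmod ((\<psi> (u k) - \<psi> z0) / ?r) \<le> 2 * \<epsilon> * ((cmod (u k + cnj z0))\<^sup>2 / Re (u k)) / r k"
      by simp
    also have "\<dots> = 2 * \<epsilon> * ((cmod (u k / ?r + cnj z0 / ?r))\<^sup>2 / Re (u k / ?r))"
      using rk by (simp add: add_divide_distrib[symmetric] norm_divide power_divide Re_divide_of_real power2_eq_square)
    finally have 1: "cmod ((\<psi> (u k) - \<psi> z0) / ?r) \<le> 2 * \<epsilon> * ((cmod (u k / ?r + cnj z0 / ?r))\<^sup>2 / Re (u k / ?r))" .
    have "\<phi> (u k) / ?r - of_real c = (\<psi> (u k) - \<psi> z0) / ?r + \<psi> z0 / ?r + (of_real (c - \<epsilon>) * (u k / ?r) - of_real c)"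
      using rk by (simp add: \<psi>_def field_simps)
    then have "dist (\<phi> (u k) / ?r) (of_real c) \<le>
        cmod ((\<psi> (u k) - \<psi> z0) / ?r) + cmod (\<psi> z0 / ?r) + cmod (of_real (c - \<epsilon>) * (u k / ?r) - of_real c)"
      unfolding dist_norm by (simp only: norm_triangle_mono[OF norm_triangle_ineq order_refl])
    also have "\<dots> \<le> h k"
      unfolding h_def using 1 by simp
    finally show ?case using elim by simp
  qed
qed

text \<open>Divided by \<open>c\<close>^n (k + 1), the n-th iterates have limit 1, so they are again
  asymptotic to the real axis and one more application of \<phi> multiplies the limit by c. Starting
  at k + 1 avoids 0, which is not in the half-plane.\<close>

lemma iterates_at_infinity:
  assumes phi: "\<phi> holomorphic_on RHP" "\<phi> ` RHP \<subseteq> RHP" and c: "c > 0"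
    and ge: "\<And>z. z \<in> RHP \<Longrightarrow> c * Re z \<le> Re (\<phi> z)"
    and inf: "\<And>\<epsilon>. \<epsilon> > 0 \<Longrightarrow> \<exists>z\<in>RHP. Re (\<phi> z) < (c + \<epsilon>) * Re z"
  shows "(\<lambda>k. (\<phi> ^^ n) (of_nat (Suc k)) / of_real (real (Suc k))) \<longlonglongrightarrow> of_real (c ^ n)"
proof (induction n)
  case 0
  have "(\<lambda>k. (\<phi> ^^ 0) (of_nat (Suc k)) / of_real (real (Suc k))) = (\<lambda>k. 1)"
    by (simp add: fun_eq_iff del: of_nat_Suc)
  then show ?case by simp
next
  case (Suc n)
  define u where "u k = (\<phi> ^^ n) (of_nat (Suc k))" for k
  define r where "r k = c ^ n * real (Suc k)" for k
  have u: "u k \<in> RHP" for k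
  proof -
    have "(\<phi> ^^ n) z \<in> RHP" if "z \<in> RHP" for z
      using that phi(2) by (induction n) auto
    then show ?thesis by (simp add: u_def RHP_iff)
  qed
  have r: "filterlim r at_top sequentially"
    unfolding r_def using c
    by (intro filterlim_tendsto_pos_mult_at_top[OF tendsto_const]
        filterlim_compose[OF filterlim_real_sequentially filterlim_Suc]) simp
  have cn: "complex_of_real (c ^ n) \<noteq> 0" using c by simp
  have "(\<lambda>k. u k / of_real (real (Suc k)) / of_real (c ^ n)) \<longlonglongrightarrow> of_real (c ^ n) / of_real (c ^ n)"
    unfolding u_def by (intro tendsto_divide Suc.IH tendsto_const cn)
  then have "(\<lambda>k. u k / of_real (r k)) \<longlonglongrightarrow> 1"
    unfolding divide_self[OF cn] by (simp add: r_def mult.commute)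
  from angular_derivative_at_infinity[OF phi(1) ge inf u r this]
 have "(\<lambda>k. of_real (c ^ n) * (\<phi> (u k) / of_real (r k))) \<longlonglongrightarrow> of_real (c ^ n) * of_real c"
    by (intro tendsto_intros)
  moreover have "of_real (c ^ n) * (\<phi> (u k) / of_real (r k)) = (\<phi> ^^ Suc n) (of_nat (Suc k)) / of_real (real (Suc k))" for k
    using c by (simp add: r_def u_def del: of_nat_Suc)
  ultimately show ?case by (simp add: mult.commute)
qed

section \<open>Bounded operators and Neumann series\<close>

lemma H2_bounded_operatorD:
  assumes "H2_bounded_operator T"
  shows "f \<in> H2 \<Longrightarrow> T f \<in> H2"
    and "f \<in> H2 \<Longrightarrow> g \<in> H2 \<Longrightarrow> T (\<lambda>z. f z + g z) = (\<lambda>z. T f z + T g z)"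
    and "f \<in> H2 \<Longrightarrow> T (\<lambda>z. a * f z) = (\<lambda>z. a * T f z)"
  using assms by (auto simp: H2_bounded_operator_def)

lemma H2_bounded_operator_diff:
  assumes "H2_bounded_operator T" "f \<in> H2" "g \<in> H2"
  shows "T (\<lambda>z. f z - g z) = (\<lambda>z. T f z - T g z)"
  using H2_bounded_operatorD(2)[OF assms(1,2) H2_cmult[OF assms(3), of "-1"]]
    H2_bounded_operatorD(3)[OF assms(1,3), of "-1"] by simp

lemma H2_bounded_operator_bound:
  assumes "H2_bounded_operator T"
  obtains M where "M > 0" "\<And>f. f \<in> H2 \<Longrightarrow> H2_norm (T f) \<le> M * H2_norm f"
proof -
  obtain M where M: "\<forall>f\<in>H2. H2_norm (T f) \<le> M * H2_norm f"
    using assms by (auto simp: H2_bounded_operator_def)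
  have "H2_norm (T f) \<le> max M 1 * H2_norm f" if "f \<in> H2" for f
    using M that order_trans[OF _ mult_right_mono[OF max.cobounded1[of M 1] H2_norm_nonneg[of f]]]
    by blast
  then show ?thesis by (intro that[of "max M 1"]) auto
qed

section \<open>The operator norm\<close>

lemma H2_operator_norm_upper:
  assumes T: "H2_bounded_operator T" and f: "f \<in> H2" "H2_norm f \<le> 1"
  shows "H2_norm (T f) \<le> H2_operator_norm T"
proof -
  obtain M where M: "M > 0" "\<And>f. f \<in> H2 \<Longrightarrow> H2_norm (T f) \<le> M * H2_norm f"
    using H2_bounded_operator_bound[OF T] by blast
  have "bdd_above ((\<lambda>f. H2_norm (T f)) ` {f \<in> H2. H2_norm f \<le> 1})"
  proof (rule bdd_aboveI2)
    fix g assume g: "g \<in> {f \<in> H2. H2_norm f \<le> 1}"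
    then have "M * H2_norm g \<le> M * 1"
      using M(1) by (intro mult_left_mono) auto
    then show "H2_norm (T g) \<le> M"
      using M(2)[of g] g by simp
  qed
  then show ?thesis
    unfolding H2_operator_norm_def using f by (intro cSUP_upper) auto
qed

lemma H2_operator_norm_nonneg:
  assumes "H2_bounded_operator T" shows "0 \<le> H2_operator_norm T"
proof -
  have "H2_norm (T (\<lambda>_. 0)) \<le> H2_operator_norm T"
    by (intro H2_operator_norm_upper[OF assms]) (simp_all add: H2_zero)
  then show ?thesis using H2_norm_nonneg[of "T (\<lambda>_. 0)"] by linarith
qed

lemma H2_operator_norm_bound:
  assumes T: "H2_bounded_operator T" and f: "f \<in> H2"
  shows "H2_norm (T f) \<le> H2_operator_norm T * H2_norm f"
\<comment> \<open>A function of norm 0 cannot be normalised; boundedness alone forces its image to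
  have norm 0.\<close>
proof (cases "H2_norm f = 0")
  case True
  obtain M where "\<And>f. f \<in> H2 \<Longrightarrow> H2_norm (T f) \<le> M * H2_norm f"
    using H2_bounded_operator_bound[OF T] by blast
  from this[OF f] True show ?thesis by simp
next
  case False
  then have pos: "H2_norm f > 0" using H2_norm_nonneg[of f] by linarith
  define a where "a = complex_of_real (1 / H2_norm f)"
  have a: "cmod a = 1 / H2_norm f" using pos by (simp add: a_def norm_divide)
  have "H2_norm (T (\<lambda>z. a * f z)) \<le> H2_operator_norm T"
    using H2_cmult[OF f] pos by (intro H2_operator_norm_upper[OF T]) (simp_all add: H2_norm_cmult[OF f] a)
  also have "H2_norm (T (\<lambda>z. a * f z)) = H2_norm (T f) / H2_norm f"
    using H2_bounded_operatorD(1,3)[OF T f] by (simp add: H2_norm_cmult a)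
  finally show ?thesis
    using pos by (simp add: field_simps)
qed

lemma H2_operator_norm_le:
  assumes "\<And>f. f \<in> H2 \<Longrightarrow> H2_norm (T f) \<le> L * H2_norm f" "L \<ge> 0"
  shows "H2_operator_norm T \<le> L"
  unfolding H2_operator_norm_def
proof (rule cSUP_least)
  show "{f \<in> H2. H2_norm f \<le> 1} \<noteq> {}"
    using H2_zero by (intro ex_in_conv[THEN iffD1] exI[of _ "\<lambda>_. 0"]) simp
  fix f assume f: "f \<in> {f \<in> H2. H2_norm f \<le> 1}"
  then have "L * H2_norm f \<le> L * 1"
    using assms(2) by (intro mult_left_mono) auto
  then show "H2_norm (T f) \<le> L"
    using assms(1)[of f] f by simp
qed

section \<open>Finite sums, pointwise limits and iterates\<close>

lemma H2_sum:
  fixes n :: nat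
  assumes "\<And>i. i < n \<Longrightarrow> f i \<in> H2"
  shows "(\<lambda>z. \<Sum>i<n. f i z) \<in> H2 \<and> H2_norm (\<lambda>z. \<Sum>i<n. f i z) \<le> (\<Sum>i<n. H2_norm (f i))"
  using assms
proof (induction n)
  case (Suc n)
  then have "(\<lambda>z. \<Sum>i<n. f i z) \<in> H2" "H2_norm (\<lambda>z. \<Sum>i<n. f i z) \<le> (\<Sum>i<n. H2_norm (f i))"
    "f n \<in> H2" by auto
  then show ?case
    using H2_add[of "\<lambda>z. \<Sum>i<n. f i z" "f n"] H2_norm_triangle[of "\<lambda>z. \<Sum>i<n. f i z" "f n"] by simp
qed (simp add: H2_zero)

text \<open>Fatou's lemma on each vertical line. It stands in for completeness: series are summed
  pointwise, and only the norm bound has to survive the limit.\<close>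

lemma H2_pointwise_limit:
  assumes f: "\<And>n. f n \<in> H2" "\<And>n. H2_norm (f n) \<le> B" and g: "g holomorphic_on RHP" "\<And>z. z \<notin> RHP \<Longrightarrow> g z = 0"
    and lim: "\<And>z. z \<in> RHP \<Longrightarrow> (\<lambda>n. f n z) \<longlonglongrightarrow> g z"
  shows "g \<in> H2" "H2_norm g \<le> B"
proof -
  have B: "B \<ge> 0" using f(2)[of 0] H2_norm_nonneg[of "f 0"] by linarith
  have "line_sq x g \<le> ennreal (2 * pi * B\<^sup>2)" if x: "x > 0" for x
  proof -
    have [measurable]: "f n \<in> borel_measurable borel" for n
      by (rule H2_measurable[OF f(1)])
    have "ennreal ((cmod (g (Complex x y)))\<^sup>2) = liminf (\<lambda>n. ennreal ((cmod (f n (Complex x y)))\<^sup>2))" for y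
      using x by (intro lim_imp_Liminf[symmetric] tendsto_ennrealI tendsto_intros lim) (auto simp: RHP_iff)
    then have "line_sq x g = (\<integral>\<^sup>+ y. liminf (\<lambda>n. ennreal ((cmod (f n (Complex x y)))\<^sup>2)) \<partial>lborel)"
      unfolding line_sq_def by simp
    also have "\<dots> \<le> liminf (\<lambda>n. line_sq x (f n))"
      unfolding line_sq_def by (rule nn_integral_liminf) measurable
    also have "\<dots> \<le> liminf (\<lambda>n. ennreal (2 * pi * B\<^sup>2))"
    proof (intro Liminf_mono always_eventually allI)
      fix n
      have "line_sq x (f n) \<le> ennreal (2 * pi * (H2_norm (f n))\<^sup>2)"
        by (rule line_sq_le[OF f(1) x])
      also have "\<dots> \<le> ennreal (2 * pi * B\<^sup>2)"
        using f(2)[of n] H2_norm_nonneg[of "f n"] by (intro ennreal_leI mult_left_mono power_mono) auto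
      finally show "line_sq x (f n) \<le> ennreal (2 * pi * B\<^sup>2)" .
    qed
    also have "\<dots> = ennreal (2 * pi * B\<^sup>2)"
      by (simp add: Liminf_const)
    finally show ?thesis .
  qed
  then show "g \<in> H2" "H2_norm g \<le> B"
    using H2I[OF g B] by auto
qed

text \<open>The case n = 0 is where vanishing off the half-plane enters; for n > 0 the operator
  itself supplies the zeros.\<close>

lemma composition_operator_iterate:
  assumes "\<phi> ` RHP \<subseteq> RHP" "\<And>z. z \<notin> RHP \<Longrightarrow> f z = 0"
  shows "(composition_operator \<phi> ^^ n) f = (\<lambda>z. if z \<in> RHP then f ((\<phi> ^^ n) z) else 0)"
proof (induction n)
  case (Suc n)
  have "\<phi> z \<in> RHP" if "z \<in> RHP" for z using assms(1) that by auto
  then show ?case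
    unfolding funpow.simps o_apply Suc.IH by (auto simp: composition_operator_def funpow_swap1)
qed (use assms(2) in auto)

lemma funpow_H2_norm_le:
  assumes T: "\<And>f. f \<in> H2 \<Longrightarrow> T f \<in> H2" "\<And>f. f \<in> H2 \<Longrightarrow> H2_norm (T f) \<le> L * H2_norm f" "L \<ge> 0"
    and f: "f \<in> H2"
  shows "(T ^^ n) f \<in> H2 \<and> H2_norm ((T ^^ n) f) \<le> L ^ n * H2_norm f"
proof (induction n)
  case (Suc n)
  have "H2_norm ((T ^^ Suc n) f) \<le> L * H2_norm ((T ^^ n) f)"
    using Suc T(2) by simp
  also have "\<dots> \<le> L * (L ^ n * H2_norm f)"
    using Suc T(3) by (intro mult_left_mono) auto
  finally show ?case using Suc T(1) by (simp add: mult.assoc)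
qed (use f in simp)

text \<open>The Neumann series converges pointwise by the bound on point evaluations, and composition
  operators act on pointwise sums term by term.\<close>

lemma spectrum_composition_operator_bound:
  assumes phi: "\<phi> ` RHP \<subseteq> RHP" and T: "H2_bounded_operator (composition_operator \<phi>)"
    and mu: "cmod \<mu> > L" and L: "L \<ge> 0"
    "\<And>f. f \<in> H2 \<Longrightarrow> H2_norm (composition_operator \<phi> f) \<le> L * H2_norm f"
  shows "\<mu> \<notin> H2_spectrum (composition_operator \<phi>)"
proof -
  let ?T = "composition_operator \<phi>"
  have mu0: "\<mu> \<noteq> 0" using mu L(1) by auto
  have phiR: "\<phi> z \<in> RHP" if "z \<in> RHP" for z using phi that by auto
  define a where "a f n z = (?T ^^ n) f z / \<mu> ^ Suc n" for f n z
  \<comment> \<open>The inverse of T - \<mu> as the Neumann series of the terms -T^n / \<mu>^(n+1),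
    written through the values of f on the orbit of z.\<close>
  define S where "S f z = (if z \<in> RHP then - (\<Sum>n. f ((\<phi> ^^ n) z) / \<mu> ^ Suc n) else 0)" for f z
  have a_eq: "a f n z = f ((\<phi> ^^ n) z) / \<mu> ^ Suc n" if "f \<in> H2" "z \<in> RHP" for f n z
    unfolding a_def using composition_operator_iterate[OF phi H2_outside[OF that(1)]] that(2) by simp
  have Tn: "(?T ^^ n) f \<in> H2" "H2_norm ((?T ^^ n) f) \<le> L ^ n * H2_norm f" if "f \<in> H2" for f n
    using funpow_H2_norm_le[of ?T L f n] H2_bounded_operatorD(1)[OF T] L that by auto
  \<comment> \<open>Bounds the norm of the n-th term relative to f; geometric with ratio L / |\<mu>|
    < 1.\<close>
  define q where "q n = L ^ n / cmod \<mu> ^ Suc n" for n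
  have q_eq: "q = (\<lambda>n. inverse (cmod \<mu>) * (L / cmod \<mu>) ^ n)"
    using mu0 by (simp add: q_def fun_eq_iff power_divide field_simps)
  have ratio: "norm (L / cmod \<mu>) < 1" using mu L(1) mu0 by simp
  have q_sum: "summable q"
    unfolding q_eq by (intro summable_mult summable_geometric ratio)
  have q0: "q n \<ge> 0" for n using L(1) by (simp add: q_def)
  have aH2: "a f n \<in> H2" "H2_norm (a f n) \<le> q n * H2_norm f" if "f \<in> H2" for f n
  proof -
    have eq: "a f n = (\<lambda>z. inverse (\<mu> ^ Suc n) * (?T ^^ n) f z)"
      by (simp add: a_def fun_eq_iff divide_inverse mult.commute)
    show "a f n \<in> H2" unfolding eq by (rule H2_cmult[OF Tn(1)[OF that]])
    have "H2_norm (a f n) = cmod (inverse (\<mu> ^ Suc n)) * H2_norm ((?T ^^ n) f)"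
      unfolding eq by (rule H2_norm_cmult[OF Tn(1)[OF that]])
    also have "\<dots> \<le> cmod (inverse (\<mu> ^ Suc n)) * (L ^ n * H2_norm f)"
      by (intro mult_left_mono Tn that) simp
    also have "\<dots> = q n * H2_norm f"
      by (simp add: q_def norm_inverse norm_power norm_mult divide_inverse)
    finally show "H2_norm (a f n) \<le> q n * H2_norm f" .
  qed
  have a_bound: "cmod (a f n z) \<le> q n * (4 * H2_norm f / sqrt d)" if "f \<in> H2" "0 < d" "d \<le> Re z" for f n z d
  proof -
    have "cmod (a f n z) \<le> 4 * H2_norm (a f n) / sqrt (Re z)"
      using that by (intro H2_point_evaluation aH2) (auto simp: RHP_iff)
    also have "\<dots> \<le> 4 * (q n * H2_norm f) / sqrt d"
      using that q0[of n] H2_norm_nonneg[of f] by (intro frac_le mult_left_mono aH2) auto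
    finally show ?thesis by (simp add: mult_ac)
  qed
  have a_summable: "summable (\<lambda>n. f ((\<phi> ^^ n) z) / \<mu> ^ Suc n)" if "f \<in> H2" "z \<in> RHP" for f z
  proof (rule summable_comparison_test')
    show "summable (\<lambda>n. q n * (4 * H2_norm f / sqrt (Re z)))"
      by (intro summable_mult2 q_sum)
    show "norm (f ((\<phi> ^^ n) z) / \<mu> ^ Suc n) \<le> q n * (4 * H2_norm f / sqrt (Re z))" for n
      using a_bound[OF that(1), of "Re z" z n] a_eq[OF that] that(2) by (simp add: RHP_iff)
  qed
  have SH2: "S f \<in> H2 \<and> H2_norm (S f) \<le> suminf q * H2_norm f" if f: "f \<in> H2" for f
  proof -
    have part: "(\<lambda>z. \<Sum>i<n. - a f i z) \<in> H2" "H2_norm (\<lambda>z. \<Sum>i<n. - a f i z) \<le> suminf q * H2_norm f" for n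
    proof -
      have *: "(\<lambda>z. - a f i z) \<in> H2" "H2_norm (\<lambda>z. - a f i z) \<le> q i * H2_norm f" for i
        using aH2[OF f, of i] H2_minus H2_norm_minus by auto
      show "(\<lambda>z. \<Sum>i<n. - a f i z) \<in> H2" using H2_sum[of n "\<lambda>i z. - a f i z"] * by blast
      have "H2_norm (\<lambda>z. \<Sum>i<n. - a f i z) \<le> (\<Sum>i<n. H2_norm (\<lambda>z. - a f i z))"
        using H2_sum[of n "\<lambda>i z. - a f i z"] * by blast
      also have "\<dots> \<le> (\<Sum>i<n. q i * H2_norm f)" by (intro sum_mono *)
      also have "\<dots> = (\<Sum>i<n. q i) * H2_norm f" by (simp add: sum_distrib_right)
      also have "\<dots> \<le> suminf q * H2_norm f"
        by (intro mult_right_mono sum_le_suminf q_sum H2_norm_nonneg) (auto simp: q0)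
      finally show "H2_norm (\<lambda>z. \<Sum>i<n. - a f i z) \<le> suminf q * H2_norm f" .
    qed
    have hol: "S f holomorphic_on RHP"
    proof (rule holomorphic_uniform_sequence[OF open_RHP])
      show "(\<lambda>z. \<Sum>i<n. - a f i z) holomorphic_on RHP" for n
        by (intro H2_holomorphic part)
      fix z assume z: "z \<in> RHP"
      \<comment> \<open>On the disc of this radius real parts stay above d, so one convergent
        majorant serves the whole disc.\<close>
      define d where "d = Re z / 2"
      have d: "d > 0" using z by (simp add: d_def RHP_iff)
      have Re_ge: "d \<le> Re w" if "w \<in> cball z d" for w
        using that abs_Re_le_cmod[of "z - w"] by (simp add: d_def dist_norm)
      have "uniform_limit (cball z d) (\<lambda>n w. \<Sum>i<n. - a f i w) (\<lambda>w. \<Sum>i. - a f i w) sequentially"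
      proof (rule Weierstrass_m_test)
        show "norm (- a f n w) \<le> q n * (4 * H2_norm f / sqrt d)" if "w \<in> cball z d" for n w
          unfolding norm_minus_cancel by (rule a_bound[OF f d Re_ge[OF that]])
      qed (intro summable_mult2 q_sum)
      moreover have "(\<Sum>i. - a f i w) = S f w" if "w \<in> cball z d" for w
      proof -
        have w: "w \<in> RHP" using Re_ge[OF that] d by (simp add: RHP_iff)
        show ?thesis using w suminf_minus[OF a_summable[OF f w]] by (simp add: S_def a_eq[OF f w])
      qed
      ultimately have "uniform_limit (cball z d) (\<lambda>n w. \<Sum>i<n. - a f i w) (S f) sequentially"
        by (subst uniform_limit_cong') auto
      moreover have "cball z d \<subseteq> RHP" using Re_ge d by (force simp: RHP_iff)
      ultimately show "\<exists>d>0. cball z d \<subseteq> RHP \<and>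
          uniform_limit (cball z d) (\<lambda>n w. \<Sum>i<n. - a f i w) (S f) sequentially"
        using d by blast
    qed
    have "(\<lambda>n. \<Sum>i<n. - a f i z) \<longlonglongrightarrow> S f z" if z: "z \<in> RHP" for z
      using sums_minus[OF summable_sums[OF a_summable[OF f z]]] z
      by (simp add: S_def a_eq[OF f z] sums_def)
    then show ?thesis
      using H2_pointwise_limit[of "\<lambda>n z. \<Sum>i<n. - a f i z", OF part hol] by (simp add: S_def)
  qed
  have t0: "(\<lambda>n. f ((\<phi> ^^ n) z) / \<mu> ^ n) \<longlonglongrightarrow> 0" if "f \<in> H2" "z \<in> RHP" for f z
  proof -
    have "(\<lambda>n. \<mu> * (f ((\<phi> ^^ n) z) / \<mu> ^ Suc n)) \<longlonglongrightarrow> \<mu> * 0"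
      by (intro tendsto_intros summable_LIMSEQ_zero a_summable that)
    then show ?thesis using mu0 by simp
  qed
  \<comment> \<open>Both inverse identities telescope: T - \<mu> turns each term into a difference
    of neighbours, and the boundary term vanishes by \<open>t0\<close>.\<close>
  have tele: "(\<Sum>n. f ((\<phi> ^^ Suc n) z) / \<mu> ^ Suc n - f ((\<phi> ^^ n) z) / \<mu> ^ n) = - f z" if "f \<in> H2" "z \<in> RHP" for f z
    using sums_unique[OF telescope_sums[OF t0[OF that]]] by simp
  have "H2_bounded_operator S"
    unfolding H2_bounded_operator_def
  proof (intro conjI ballI allI)
    show "S f \<in> H2" if "f \<in> H2" for f using SH2[OF that] by simp
    show "\<exists>M. \<forall>f\<in>H2. H2_norm (S f) \<le> M * H2_norm f" using SH2 by blast
    show "S (\<lambda>z. f z + g z) = (\<lambda>z. S f z + S g z)" if "f \<in> H2" "g \<in> H2" for f g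
    proof
      fix z show "S (\<lambda>z. f z + g z) z = S f z + S g z"
        by (cases "z \<in> RHP")
           (simp_all add: S_def add_divide_distrib suminf_add[OF a_summable a_summable, OF that(1) _ that(2), symmetric]
             del: power_Suc)
    qed
    show "S (\<lambda>z. c * f z) = (\<lambda>z. c * S f z)" if "f \<in> H2" for f c
    proof
      fix z show "S (\<lambda>z. c * f z) z = c * S f z"
        using suminf_mult[OF a_summable[OF that, of z], of c]
        by (simp add: S_def del: power_Suc)
    qed
  qed
  moreover have "S (\<lambda>z. ?T f z - \<mu> * f z) = f" if f: "f \<in> H2" for f
  proof
    fix z show "S (\<lambda>z. ?T f z - \<mu> * f z) z = f z"
    proof (cases "z \<in> RHP")
      case True
      have "(\<phi> ^^ n) z \<in> RHP" for n using True phiR by (induction n) auto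
      then have "(?T f ((\<phi> ^^ n) z) - \<mu> * f ((\<phi> ^^ n) z)) / \<mu> ^ Suc n =
          f ((\<phi> ^^ Suc n) z) / \<mu> ^ Suc n - f ((\<phi> ^^ n) z) / \<mu> ^ n" for n
        using mu0 by (simp add: composition_operator_def diff_divide_distrib)
      then show ?thesis
        using tele[OF f True] True by (simp add: S_def)
    qed (simp add: S_def H2_outside[OF f])
  qed
  moreover have "(\<lambda>z. ?T (S f) z - \<mu> * S f z) = f" if f: "f \<in> H2" for f
  proof
    fix z show "?T (S f) z - \<mu> * S f z = f z"
    proof (cases "z \<in> RHP")
      case True
      have "?T (S f) z - \<mu> * S f z =
          \<mu> * (\<Sum>n. f ((\<phi> ^^ n) z) / \<mu> ^ Suc n) - (\<Sum>n. f ((\<phi> ^^ n) (\<phi> z)) / \<mu> ^ Suc n)"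
        using True phiR[OF True] by (simp add: composition_operator_def S_def)
      also have "\<mu> * (\<Sum>n. f ((\<phi> ^^ n) z) / \<mu> ^ Suc n) = (\<Sum>n. \<mu> * (f ((\<phi> ^^ n) z) / \<mu> ^ Suc n))"
        by (rule suminf_mult[OF a_summable[OF f True], symmetric])
      also have "\<dots> - (\<Sum>n. f ((\<phi> ^^ n) (\<phi> z)) / \<mu> ^ Suc n) =
          (\<Sum>n. \<mu> * (f ((\<phi> ^^ n) z) / \<mu> ^ Suc n) - f ((\<phi> ^^ n) (\<phi> z)) / \<mu> ^ Suc n)"
        by (rule suminf_diff[OF summable_mult[OF a_summable[OF f True]] a_summable[OF f phiR[OF True]]])
      also have "(\<lambda>n. \<mu> * (f ((\<phi> ^^ n) z) / \<mu> ^ Suc n) - f ((\<phi> ^^ n) (\<phi> z)) / \<mu> ^ Suc n) =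
          (\<lambda>n. f ((\<phi> ^^ n) z) / \<mu> ^ n - f ((\<phi> ^^ Suc n) z) / \<mu> ^ Suc n)"
        using mu0 by (simp add: fun_eq_iff funpow_swap1)
      also have "suminf \<dots> = f z"
        using sums_unique[OF telescope_sums'[OF t0[OF f True]]] by simp
      finally show ?thesis .
    qed (simp add: S_def composition_operator_def H2_outside[OF f])
  qed
  ultimately show ?thesis
    unfolding H2_spectrum_def by blast
qed

section \<open>Growth of iterates and the spectrum\<close>

text \<open>For fixed \<open>f\<close> and \<open>z\<close> the values \<open>(T\<^sup>n f) z\<close> are, up to sign, the Taylor coefficients
  at \<open>0\<close> of \<open>w \<mapsto> ((T - 1/w)\<^sup>-\<^sup>1 f) z\<close>, so Cauchy's inequality applies up to the radius allowed
  by the spectrum.\<close>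

lemma funpow_growth_outside_spectrum:
  assumes T: "H2_bounded_operator T" and s: "s > 0" and r: "r > s"
    and spec: "\<And>\<mu>. cmod \<mu> > s \<Longrightarrow> \<mu> \<notin> H2_spectrum T"
  obtains C where "C \<ge> 0"
    "\<And>n f z. f \<in> H2 \<Longrightarrow> z \<in> RHP \<Longrightarrow> cmod ((T ^^ n) f z) \<le> C * r ^ n / sqrt (Re z) * H2_norm f"
proof -
  note TD = H2_bounded_operatorD[OF T]
  have "\<exists>S. H2_bounded_operator S \<and> (\<forall>f\<in>H2. S (\<lambda>z. T f z - \<mu> * f z) = f) \<and>
             (\<forall>f\<in>H2. (\<lambda>z. T (S f) z - \<mu> * S f z) = f)" if "cmod \<mu> > s" for \<mu>
    using spec[OF that] by (simp add: H2_spectrum_def)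
  then obtain R where R: "\<And>\<mu>. cmod \<mu> > s \<Longrightarrow> H2_bounded_operator (R \<mu>)"
    and R1: "\<And>\<mu> f. cmod \<mu> > s \<Longrightarrow> f \<in> H2 \<Longrightarrow> R \<mu> (\<lambda>z. T f z - \<mu> * f z) = f"
    and R2: "\<And>\<mu> f. cmod \<mu> > s \<Longrightarrow> f \<in> H2 \<Longrightarrow> (\<lambda>z. T (R \<mu> f) z - \<mu> * R \<mu> f z) = f"
    by metis
  note RH = H2_bounded_operatorD(1)[OF R]
  \<comment> \<open>The resolvent identity, from splitting f = (T - \<mu>) g + (\<mu> - \<nu>) g
    with g = \<open>R \<nu> f\<close>. All regularity in \<mu> comes from it, since the complement
    of the spectrum supplies the inverses one by one, with unrelated bounds.\<close>
  have resolvent: "R \<mu> f = (\<lambda>z. R \<nu> f z + (\<mu> - \<nu>) * R \<mu> (R \<nu> f) z)"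
    if mu: "cmod \<mu> > s" and nu: "cmod \<nu> > s" and f: "f \<in> H2" for \<mu> \<nu> f
  proof -
    define g where "g = R \<nu> f"
    have g: "g \<in> H2" unfolding g_def by (rule RH[OF nu f])
    have h: "(\<lambda>z. T g z - \<mu> * g z) \<in> H2"
      by (intro H2_diff H2_cmult TD(1) g)
    have "f = (\<lambda>z. (T g z - \<mu> * g z) + (\<mu> - \<nu>) * g z)"
      using R2[OF nu f] by (simp add: g_def fun_eq_iff algebra_simps)
    then have "R \<mu> f = R \<mu> (\<lambda>z. (T g z - \<mu> * g z) + (\<mu> - \<nu>) * g z)" by simp
    also have "\<dots> = (\<lambda>z. R \<mu> (\<lambda>z. T g z - \<mu> * g z) z + R \<mu> (\<lambda>z. (\<mu> - \<nu>) * g z) z)"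
      by (rule H2_bounded_operatorD(2)[OF R[OF mu] h H2_cmult[OF g]])
    also have "\<dots> = (\<lambda>z. g z + (\<mu> - \<nu>) * R \<mu> g z)"
      unfolding R1[OF mu g] H2_bounded_operatorD(3)[OF R[OF mu] g] ..
    finally show ?thesis unfolding g_def .
  qed
  have "\<exists>B>0. \<forall>f\<in>H2. H2_norm (R \<mu> f) \<le> B * H2_norm f" if "cmod \<mu> > s" for \<mu>
    using H2_bounded_operator_bound[OF R[OF that]] by metis
  then obtain B where B: "\<And>\<mu>. cmod \<mu> > s \<Longrightarrow> B \<mu> > 0"
    "\<And>\<mu> f. cmod \<mu> > s \<Longrightarrow> f \<in> H2 \<Longrightarrow> H2_norm (R \<mu> f) \<le> B \<mu> * H2_norm f"
    by metis
  define \<rho> where "\<rho> \<nu> = 1 / (2 * B \<nu>)" for \<nu>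
  \<comment> \<open>Within \<rho> \<nu> the correction term of the resolvent identity is at most
    half of the norm being estimated, and is absorbed at the price of a factor 2.\<close>
  have local_bound: "H2_norm (R \<mu> f) \<le> 2 * B \<nu> * H2_norm f"
    if mu: "cmod \<mu> > s" and nu: "cmod \<nu> > s" and near: "cmod (\<nu> - \<mu>) < \<rho> \<nu>" and f: "f \<in> H2" for \<mu> \<nu> f
  proof -
    let ?g = "R \<mu> f"
    have g: "?g \<in> H2" by (rule RH[OF mu f])
    have "?g = (\<lambda>z. R \<nu> f z - (\<nu> - \<mu>) * R \<nu> ?g z)"
      using resolvent[OF nu mu f] by (simp add: fun_eq_iff)
    then have "H2_norm ?g = H2_norm (\<lambda>z. R \<nu> f z - (\<nu> - \<mu>) * R \<nu> ?g z)"
      by (rule arg_cong)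
    also have "\<dots> \<le> H2_norm (R \<nu> f) + H2_norm (\<lambda>z. (\<nu> - \<mu>) * R \<nu> ?g z)"
      by (intro H2_norm_triangle_diff H2_cmult RH[OF nu] f g)
    also have "H2_norm (\<lambda>z. (\<nu> - \<mu>) * R \<nu> ?g z) = cmod (\<nu> - \<mu>) * H2_norm (R \<nu> ?g)"
      by (rule H2_norm_cmult[OF RH[OF nu g]])
    also have "\<dots> \<le> \<rho> \<nu> * (B \<nu> * H2_norm ?g)"
      using near B(1)[OF nu] by (intro mult_mono B nu g) (auto simp: \<rho>_def H2_norm_nonneg)
    also have "\<dots> = H2_norm ?g / 2"
      using B(1)[OF nu] by (simp add: \<rho>_def)
    finally have "H2_norm ?g \<le> 2 * H2_norm (R \<nu> f)" by simp
    also have "\<dots> \<le> 2 * (B \<nu> * H2_norm f)"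
      by (intro mult_left_mono B nu f) simp
    finally show ?thesis by simp
  qed
  have rho: "\<rho> \<nu> > 0" if "cmod \<nu> > s" for \<nu>
    using B(1)[OF that] by (simp add: \<rho>_def)
  have near_ev: "\<forall>\<^sub>F \<mu> in at \<nu>. cmod \<mu> > s \<and> cmod (\<nu> - \<mu>) < \<rho> \<nu> \<and> \<mu> \<noteq> \<nu>" if nu: "cmod \<nu> > s" for \<nu>
  proof -
    have "\<forall>\<^sub>F \<mu> in at \<nu>. cmod \<mu> > s"
      using nu by (intro order_tendstoD(1)[OF tendsto_norm[OF tendsto_ident_at]])
    moreover have "\<forall>\<^sub>F \<mu> in at \<nu>. dist \<mu> \<nu> < \<rho> \<nu>"
      by (rule tendstoD[OF tendsto_ident_at rho[OF nu]])
    moreover have "\<forall>\<^sub>F \<mu> in at \<nu>. \<mu> \<noteq> \<nu>"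
      by (simp add: eventually_at_filter)
    ultimately show ?thesis
      by eventually_elim (simp add: dist_norm norm_minus_commute)
  qed
  have cont: "((\<lambda>\<mu>. R \<mu> g z) \<longlongrightarrow> R \<nu> g z) (at \<nu>)" if nu: "cmod \<nu> > s" and g: "g \<in> H2" and z: "z \<in> RHP" for \<nu> g z
  proof -
    define K where "K = 4 * (2 * B \<nu> * H2_norm (R \<nu> g)) / sqrt (Re z)"
    have "\<forall>\<^sub>F \<mu> in at \<nu>. norm (R \<mu> g z - R \<nu> g z) \<le> cmod (\<mu> - \<nu>) * K"
      using near_ev[OF nu]
    proof eventually_elim
      case (elim \<mu>)
      have "R \<mu> g z - R \<nu> g z = (\<mu> - \<nu>) * R \<mu> (R \<nu> g) z"
        using resolvent[OF _ nu g, of \<mu>] elim by (metis add_diff_cancel_left')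
      moreover have "cmod (R \<mu> (R \<nu> g) z) \<le> 4 * H2_norm (R \<mu> (R \<nu> g)) / sqrt (Re z)"
        using elim by (intro H2_point_evaluation RH nu g z) auto
      moreover have "\<dots> \<le> K"
        unfolding K_def using elim z
        by (intro divide_right_mono mult_left_mono local_bound RH nu g) (auto simp: RHP_iff)
      ultimately show ?case
        by (simp add: norm_mult mult_left_mono)
    qed
    moreover have "((\<lambda>\<mu>. cmod (\<mu> - \<nu>) * K) \<longlongrightarrow> 0) (at \<nu>)"
      by (auto intro!: tendsto_eq_intros)
    ultimately have "((\<lambda>\<mu>. R \<mu> g z - R \<nu> g z) \<longlongrightarrow> 0) (at \<nu>)"
      by (rule Lim_null_comparison)
    then show ?thesis by (simp add: LIM_zero_iff)
  qed
  \<comment> \<open>By the resolvent identity the difference quotient is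
    \<open>R \<mu> (R \<nu> f) z\<close>, and \<open>cont\<close> for \<open>R \<nu> f\<close> gives
    its limit.\<close>
  have hol: "(\<lambda>\<mu>. R \<mu> f z) holomorphic_on {\<mu>. cmod \<mu> > s}" if f: "f \<in> H2" and z: "z \<in> RHP" for f z
  proof -
    have "((\<lambda>\<mu>. R \<mu> f z) has_field_derivative R \<nu> (R \<nu> f) z) (at \<nu>)" if nu: "cmod \<nu> > s" for \<nu>
      unfolding has_field_derivative_iff
    proof (rule Lim_transform_eventually)
      show "((\<lambda>\<mu>. R \<mu> (R \<nu> f) z) \<longlongrightarrow> R \<nu> (R \<nu> f) z) (at \<nu>)"
        by (rule cont[OF nu RH[OF nu f] z])
      show "\<forall>\<^sub>F \<mu> in at \<nu>. R \<mu> (R \<nu> f) z = (R \<mu> f z - R \<nu> f z) / (\<mu> - \<nu>)"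
        using near_ev[OF nu]
      proof eventually_elim
        case (elim \<mu>)
        have "R \<mu> f z - R \<nu> f z = (\<mu> - \<nu>) * R \<mu> (R \<nu> f) z"
          using resolvent[OF _ nu f, of \<mu>] elim by (metis add_diff_cancel_left')
        then show ?case using elim by simp
      qed
    qed
    then show ?thesis
      unfolding holomorphic_on_def field_differentiable_def
      by (blast intro: has_field_derivative_at_within)
  qed
  obtain M where M: "M > 0" "\<And>f. f \<in> H2 \<Longrightarrow> H2_norm (T f) \<le> M * H2_norm f"
    using H2_bounded_operator_bound[OF T] by blast
  \<comment> \<open>For |\<mu>| > 2 M the term T g is absorbed by half of \<mu> g. This decay makes
    0 a removable singularity of \<open>G\<close> below, with value 0.\<close>
  have decay: "H2_norm (R \<mu> f) \<le> 2 * H2_norm f / cmod \<mu>"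
    if mu: "cmod \<mu> > s" "cmod \<mu> > 2 * M" and f: "f \<in> H2" for \<mu> f
  proof -
    let ?g = "R \<mu> f"
    have g: "?g \<in> H2" by (rule RH[OF mu(1) f])
    have "cmod \<mu> * H2_norm ?g = H2_norm (\<lambda>z. \<mu> * ?g z)"
      by (rule H2_norm_cmult[OF g, symmetric])
    also have "(\<lambda>z. \<mu> * ?g z) = (\<lambda>z. T ?g z - f z)"
      using R2[OF mu(1) f] by (auto simp: fun_eq_iff algebra_simps)
    also have "H2_norm \<dots> \<le> H2_norm (T ?g) + H2_norm f"
      by (intro H2_norm_triangle_diff TD(1) g f)
    also have "H2_norm (T ?g) \<le> M * H2_norm ?g"
      by (rule M(2)[OF g])
    also have "\<dots> \<le> cmod \<mu> / 2 * H2_norm ?g"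
      using mu by (intro mult_right_mono) (auto simp: H2_norm_nonneg)
    finally have "cmod \<mu> * H2_norm ?g \<le> 2 * H2_norm f" by simp
    moreover have "cmod \<mu> > 0" using mu(1) s by linarith
    ultimately show ?thesis by (simp add: pos_le_divide_eq mult.commute)
  qed
  \<comment> \<open>The variable w = 1 / \<mu> carries the exterior of the disc of radius s to the
    punctured disc of radius 1 / s. The expected expansion has the terms -w^(n+1) (T^n f) z.\<close>
  define G where "G f z w = (if w = 0 then 0 else R (1 / w) f z)" for f z w
  have inv: "cmod (1 / w) > s" if "cmod w < 1 / s" "w \<noteq> 0" for w
    using that s by (simp add: norm_divide field_simps)
  have G_hol: "G f z holomorphic_on ball 0 (1 / s)" if f: "f \<in> H2" and z: "z \<in> RHP" for f z
  proof (rule no_isolated_singularity'[of "{0}"])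
    have "(\<lambda>w. R (1 / w) f z) holomorphic_on (ball 0 (1 / s) - {0})"
      using inv by (intro holomorphic_on_compose_gen[OF _ hol[OF f z], unfolded o_def] holomorphic_intros) auto
    then show "G f z holomorphic_on (ball 0 (1 / s) - {0})"
      by (rule holomorphic_transform) (auto simp: G_def)
    fix w assume "w \<in> {0::complex}"
    then have w: "w = 0" by simp
    have "((\<lambda>w. G f z w) \<longlongrightarrow> 0) (at 0)"
    proof (rule Lim_null_comparison)
      define e where "e = min (1 / s) (1 / (2 * M))"
      have e: "e > 0" using s M by (simp add: e_def)
      have "\<forall>\<^sub>F w in at 0. dist w (0::complex) < e"
        by (rule tendstoD[OF tendsto_ident_at e])
      then show "\<forall>\<^sub>F w in at 0. norm (G f z w) \<le> cmod w * (4 * (2 * H2_norm f) / sqrt (Re z))"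
      proof eventually_elim
        case (elim w)
        show ?case
        proof (cases "w = 0")
          case False
          then have w: "cmod (1 / w) > s" "cmod (1 / w) > 2 * M"
            using elim s M(1) by (auto simp: e_def norm_divide field_simps)
          have "norm (G f z w) \<le> 4 * H2_norm (R (1 / w) f) / sqrt (Re z)"
            using False w by (simp add: G_def) (intro H2_point_evaluation RH f z, simp)
          also have "\<dots> \<le> 4 * (2 * H2_norm f / cmod (1 / w)) / sqrt (Re z)"
            using z by (intro divide_right_mono mult_left_mono decay w f) (auto simp: RHP_iff)
          finally show ?thesis by (simp add: norm_divide field_simps)
        qed (simp add: G_def)
      qed
      show "((\<lambda>w. cmod w * (4 * (2 * H2_norm f) / sqrt (Re z))) \<longlongrightarrow> 0) (at 0)"
        by (rule tendsto_mult_left_zero) (auto intro!: tendsto_eq_intros)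
    qed
    then have "(G f z \<longlongrightarrow> 0) (at 0 within ball 0 (1 / s))"
      by (rule tendsto_within_subset) simp
    moreover have "G f z 0 = 0" by (simp add: G_def)
    ultimately show "(G f z \<longlongrightarrow> G f z w) (at w within ball 0 (1 / s))"
      unfolding w by simp
  qed auto
  have G_exp: "G f z has_fps_expansion fps_expansion (G f z) 0" if "f \<in> H2" "z \<in> RHP" for f z
    using s by (intro has_fps_expansion_fps_expansion[OF _ _ G_hol[OF that]]) auto
  \<comment> \<open>The identity R (T - \<mu>) f = f in the variable w. On power series it shifts
    the coefficients and replaces f by T f, which determines them recursively.\<close>
  have G_rec: "G f z w = w * (G (T f) z w - f z)" if f: "f \<in> H2" and w: "cmod w < 1 / s" for f z w
  proof (cases "w = 0")
    case False
    let ?mu = "1 / w"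
    have mu: "cmod ?mu > s" by (rule inv[OF w False])
    have "f = R ?mu (\<lambda>z. T f z - ?mu * f z)"
      by (rule R1[OF mu f, symmetric])
    also have "\<dots> = (\<lambda>z. R ?mu (T f) z - ?mu * R ?mu f z)"
      unfolding H2_bounded_operator_diff[OF R[OF mu] TD(1)[OF f] H2_cmult[OF f]]
        H2_bounded_operatorD(3)[OF R[OF mu] f] ..
    finally have "f z = R ?mu (T f) z - ?mu * R ?mu f z"
      by (rule fun_cong)
    then show ?thesis using False by (simp add: G_def)
  qed (simp add: G_def)
  have coeff_rec: "fps_expansion (G f z) 0 = fps_X * (fps_expansion (G (T f) z) 0 - fps_const (f z))"
    if f: "f \<in> H2" and z: "z \<in> RHP" for f z
  proof (rule fps_expansion_unique_complex[OF G_exp[OF f z]])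
    have "(\<lambda>w. w * (G (T f) z w - f z)) has_fps_expansion
        fps_X * (fps_expansion (G (T f) z) 0 - fps_const (f z))"
      by (intro fps_expansion_intros G_exp TD(1) f z)
    moreover have ev: "\<forall>\<^sub>F w in nhds 0. w * (G (T f) z w - f z) = G f z w"
      unfolding eventually_nhds_metric using s
      by (intro exI[of _ "1 / s"]) (auto simp: G_rec[OF f])
    ultimately show "G f z has_fps_expansion fps_X * (fps_expansion (G (T f) z) 0 - fps_const (f z))"
      by (simp only: has_fps_expansion_cong[OF ev refl])
  qed
  have coeff0: "fps_nth (fps_expansion (G f z) 0) 0 = 0" for f z
    by (simp add: fps_expansion_def G_def)
  have coeff: "fps_nth (fps_expansion (G f z) 0) (Suc n) = - ((T ^^ n) f z)" if "f \<in> H2" "z \<in> RHP" for f z n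
    using that(1)
  proof (induction n arbitrary: f)
    case 0
    then show ?case by (simp add: coeff_rec[OF 0 that(2)] coeff0)
  next
    case (Suc n)
    have "fps_nth (fps_expansion (G f z) 0) (Suc (Suc n)) = fps_nth (fps_expansion (G (T f) z) 0) (Suc n)"
      by (simp add: coeff_rec[OF Suc.prems that(2)])
    then show ?case
      using Suc.IH[OF TD(1)[OF Suc.prems]] by (simp add: funpow_swap1)
  qed
  have r0: "r > 0" using r s by simp
  \<comment> \<open>Compactness of the circle turns the local bounds into one; the sum over the
    finite subcover is a crude maximum.\<close>
  obtain D where D: "D \<subseteq> sphere 0 r" "finite D" "sphere 0 r \<subseteq> (\<Union>\<nu>\<in>D. ball \<nu> (\<rho> \<nu>))"
  proof (rule compactE_image[OF compact_sphere, of "sphere 0 r" "\<lambda>\<nu>. ball \<nu> (\<rho> \<nu>)" "0::complex" r])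
    show "sphere 0 r \<subseteq> (\<Union>\<nu>\<in>sphere 0 r. ball \<nu> (\<rho> \<nu>))"
      using rho r by force
  qed auto
  define K where "K = (\<Sum>\<nu>\<in>D. 2 * B \<nu>)"
  have Dr: "cmod \<nu> > s" if "\<nu> \<in> D" for \<nu> using D(1) that r by auto
  have K0: "K \<ge> 0" unfolding K_def
    using B(1)[OF Dr] by (intro sum_nonneg) (simp add: less_imp_le)
  have K: "H2_norm (R \<mu> f) \<le> K * H2_norm f" if mu: "cmod \<mu> = r" and f: "f \<in> H2" for \<mu> f
  proof -
    obtain \<nu> where nu: "\<nu> \<in> D" "\<mu> \<in> ball \<nu> (\<rho> \<nu>)" using D(3) mu by auto
    have "H2_norm (R \<mu> f) \<le> 2 * B \<nu> * H2_norm f"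
      using nu mu r by (intro local_bound f Dr[OF nu(1)]) (auto simp: dist_norm)
    also have "\<dots> \<le> K * H2_norm f"
      unfolding K_def using B(1)[OF Dr] nu D(2)
      by (intro mult_right_mono member_le_sum H2_norm_nonneg) (auto simp: less_imp_le)
    finally show ?thesis .
  qed
  show ?thesis
  proof (rule that[of "4 * K * r"])
    show "4 * K * r \<ge> 0" using K0 r0 by simp
    fix n f z assume f: "f \<in> H2" and z: "z \<in> RHP"
    have sub: "cball 0 (1 / r) \<subseteq> ball (0::complex) (1 / s)"
    proof -
      have "1 / r < 1 / s" using r s by (intro divide_strict_left_mono) auto
      then show ?thesis by (simp add: cball_subset_ball_iff)
    qed
    define b where "b = 4 * (K * H2_norm f) / sqrt (Re z)"
    have deriv_le: "cmod ((deriv ^^ Suc n) (G f z) 0) \<le> fact (Suc n) * b / (1 / r) ^ Suc n"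
    proof (rule Cauchy_inequality)
      show "G f z holomorphic_on ball 0 (1 / r)"
        using sub by (intro holomorphic_on_subset[OF G_hol[OF f z]]) auto
      show "continuous_on (cball 0 (1 / r)) (G f z)"
        using sub by (intro holomorphic_on_imp_continuous_on holomorphic_on_subset[OF G_hol[OF f z]])
      show "0 < 1 / r" using r0 by simp
      fix w :: complex assume "norm (0 - w) = 1 / r"
      then have w: "cmod (1 / w) = r" "w \<noteq> 0" using r0 by (auto simp: norm_divide)
      have "norm (G f z w) = cmod (R (1 / w) f z)" using w by (simp add: G_def)
      also have "\<dots> \<le> 4 * H2_norm (R (1 / w) f) / sqrt (Re z)"
        using w r by (intro H2_point_evaluation RH f z) simp
      also have "\<dots> \<le> 4 * (K * H2_norm f) / sqrt (Re z)"
        using z by (intro divide_right_mono mult_left_mono K w f) (auto simp: RHP_iff)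
      finally show "norm (G f z w) \<le> b" unfolding b_def .
    qed
    have "- ((T ^^ n) f z) = (deriv ^^ Suc n) (G f z) 0 / fact (Suc n)"
      using coeff[OF f z, of n] by (simp only: fps_expansion_def fps_nth_Abs_fps)
    then have "cmod ((T ^^ n) f z) = cmod ((deriv ^^ Suc n) (G f z) 0) / fact (Suc n)"
      by (metis norm_divide norm_fact norm_minus_cancel)
    also have "\<dots> \<le> (fact (Suc n) * b / (1 / r) ^ Suc n) / fact (Suc n)"
      by (rule divide_right_mono[OF deriv_le]) simp
    \<comment> \<open>The n-th iterate is coefficient n + 1; the surplus factor r goes into the
      constant.\<close>
    also have "\<dots> = b * r ^ Suc n"
      using r0 by (simp add: power_one_over del: fact_Suc power_Suc)
    also have "\<dots> = 4 * K * r * r ^ n / sqrt (Re z) * H2_norm f"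
      by (simp add: b_def)
    finally show "cmod ((T ^^ n) f z) \<le> 4 * K * r * r ^ n / sqrt (Re z) * H2_norm f" .
  qed
qed

section \<open>The constant c and the spectral lower bound\<close>

lemma composition_operator_lower_bound:
  assumes T: "H2_bounded_operator (composition_operator \<phi>)" and phi: "\<phi> ` RHP \<subseteq> RHP"
  obtains c where "c > 0" "\<And>z. z \<in> RHP \<Longrightarrow> c * Re z \<le> Re (\<phi> z)"
    "\<And>\<epsilon>. \<epsilon> > 0 \<Longrightarrow> \<exists>z\<in>RHP. Re (\<phi> z) < (c + \<epsilon>) * Re z"
proof -
  let ?T = "composition_operator \<phi>"
  obtain M where M: "M > 0" "\<And>f. f \<in> H2 \<Longrightarrow> H2_norm (?T f) \<le> M * H2_norm f"
    using H2_bounded_operator_bound[OF T] by blast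
  define Q where "Q = (\<lambda>z. Re (\<phi> z) / Re z) ` RHP"
  \<comment> \<open>Any positive lower bound would bound the norm; the infimum also provides the
    near-minimisers on which the angular derivative rests.\<close>
  define c where "c = Inf Q"
  \<comment> \<open>Evaluating f at \<phi> z is evaluating T f at z, hence bounded by 4 M / sqrt (Re
    z) times the norm of f. The kernel test then gives 32 = 2 * 4^2.\<close>
  have lower: "1 / (32 * M\<^sup>2) \<le> Re (\<phi> z) / Re z" if z: "z \<in> RHP" for z
  proof -
    have Rz: "Re z > 0" using z by (simp add: RHP_iff)
    have "1 \<le> 2 * Re (\<phi> z) * (4 * M / sqrt (Re z))\<^sup>2"
    proof (rule H2_evaluation_lower_bound)
      show "\<phi> z \<in> RHP" using phi z by auto
      show "4 * M / sqrt (Re z) \<ge> 0" using M Rz by simp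
      fix f assume f: "f \<in> H2"
      have "cmod (f (\<phi> z)) = cmod (?T f z)" using z by (simp add: composition_operator_def)
      also have "\<dots> \<le> 4 * H2_norm (?T f) / sqrt (Re z)"
        by (intro H2_point_evaluation H2_bounded_operatorD(1)[OF T] f z)
      also have "\<dots> \<le> 4 * (M * H2_norm f) / sqrt (Re z)"
        using Rz by (intro divide_right_mono mult_left_mono M f) auto
      finally show "cmod (f (\<phi> z)) \<le> 4 * M / sqrt (Re z) * H2_norm f" by simp
    qed
    then show ?thesis
      using M(1) Rz by (simp add: power_divide power_mult_distrib field_simps)
  qed
  have bdd: "bdd_below Q"
    unfolding Q_def using lower by (rule bdd_belowI2)
  have "1 \<in> RHP" by (simp add: RHP_iff)
  then have ne: "Q \<noteq> {}" unfolding Q_def by blast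
  show ?thesis
  proof (rule that)
    have "1 / (32 * M\<^sup>2) \<le> c"
      unfolding c_def using lower by (intro cInf_greatest ne) (auto simp: Q_def)
    moreover have "1 / (32 * M\<^sup>2) > 0" using M(1) by simp
    ultimately show "c > 0" by linarith
    show "c * Re z \<le> Re (\<phi> z)" if z: "z \<in> RHP" for z
    proof -
      have "c \<le> Re (\<phi> z) / Re z"
        unfolding c_def by (rule cInf_lower[OF _ bdd]) (use z in \<open>auto simp: Q_def\<close>)
      then show ?thesis using z by (simp add: RHP_iff field_simps)
    qed
    show "\<exists>z\<in>RHP. Re (\<phi> z) < (c + \<epsilon>) * Re z" if "\<epsilon> > 0" for \<epsilon>
    proof -
      have "Inf Q < c + \<epsilon>" using that by (simp add: c_def)
      then obtain z where "z \<in> RHP" "Re (\<phi> z) / Re z < c + \<epsilon>"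
        using cInf_lessD[OF ne] by (auto simp: Q_def)
      then show ?thesis by (auto simp: RHP_iff field_simps)
    qed
  qed
qed

lemma spectrum_composition_operator_large:
  assumes phi: "\<phi> holomorphic_on RHP" "\<phi> ` RHP \<subseteq> RHP" and T: "H2_bounded_operator (composition_operator \<phi>)"
    and c: "c > 0" and ge: "\<And>z. z \<in> RHP \<Longrightarrow> c * Re z \<le> Re (\<phi> z)"
    and inf: "\<And>\<epsilon>. \<epsilon> > 0 \<Longrightarrow> \<exists>z\<in>RHP. Re (\<phi> z) < (c + \<epsilon>) * Re z"
    and s: "s > 0" "s < 1 / sqrt c"
  shows "\<exists>\<mu>\<in>H2_spectrum (composition_operator \<phi>). cmod \<mu> > s"
proof (rule ccontr)
  let ?T = "composition_operator \<phi>"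
  assume "\<not> ?thesis"
  then have spec: "\<And>\<mu>. cmod \<mu> > s \<Longrightarrow> \<mu> \<notin> H2_spectrum ?T" by auto
  \<comment> \<open>Any r strictly between works: r > s is what the growth bound asks for, and r < 1
    / sqrt c makes c r^2 < 1.\<close>
  obtain r where r: "s < r" "r < 1 / sqrt c" using dense[OF s(2)] by blast
  have r0: "r > 0" using r s by simp
  obtain C where C: "C \<ge> 0"
    "\<And>n f z. f \<in> H2 \<Longrightarrow> z \<in> RHP \<Longrightarrow> cmod ((?T ^^ n) f z) \<le> C * r ^ n / sqrt (Re z) * H2_norm f"
    using funpow_growth_outside_spectrum[OF T s(1) r(1) spec] by blast
  have iter: "(\<phi> ^^ n) z \<in> RHP" if "z \<in> RHP" for n z
    using that phi(2) by (induction n) auto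
  have "1 \<le> 2 * C\<^sup>2 * (c * r\<^sup>2) ^ n" for n
  proof -
    have k: "1 \<le> 2 * (C * r ^ n)\<^sup>2 * (Re ((\<phi> ^^ n) (of_nat (Suc k))) / real (Suc k))" for k
    proof -
      let ?z = "of_nat (Suc k) :: complex"
      have z: "?z \<in> RHP" by (simp add: RHP_iff)
      have "1 \<le> 2 * Re ((\<phi> ^^ n) ?z) * (C * r ^ n / sqrt (Re ?z))\<^sup>2"
      proof (rule H2_evaluation_lower_bound[OF iter[OF z]])
        show "C * r ^ n / sqrt (Re ?z) \<ge> 0" using C(1) r0 by simp
        fix f assume f: "f \<in> H2"
        have "f ((\<phi> ^^ n) ?z) = (?T ^^ n) f ?z"
          using composition_operator_iterate[OF phi(2) H2_outside[OF f]] z by simp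
        then show "cmod (f ((\<phi> ^^ n) ?z)) \<le> C * r ^ n / sqrt (Re ?z) * H2_norm f"
          using C(2)[OF f z] by simp
      qed
      then show ?thesis
        by (simp add: power_divide mult_ac del: of_nat_Suc)
    qed
    \<comment> \<open>Here n is fixed and k tends to infinity, which turns the quotient into
      \<open>c\<close>^n; only afterwards does n grow.\<close>
    have "(\<lambda>k. Re ((\<phi> ^^ n) (of_nat (Suc k)) / of_real (real (Suc k)))) \<longlonglongrightarrow> Re (of_real (c ^ n))"
      by (rule tendsto_Re[OF iterates_at_infinity[OF phi c ge inf]])
    then have "(\<lambda>k. Re ((\<phi> ^^ n) (of_nat (Suc k))) / real (Suc k)) \<longlonglongrightarrow> c ^ n"
      by (simp only: Re_divide_of_real Re_complex_of_real)
    then have "(\<lambda>k. 2 * (C * r ^ n)\<^sup>2 * (Re ((\<phi> ^^ n) (of_nat (Suc k))) / real (Suc k))) \<longlonglongrightarrow> 2 * (C * r ^ n)\<^sup>2 * c ^ n"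
      by (intro tendsto_intros)
    then have "1 \<le> 2 * (C * r ^ n)\<^sup>2 * c ^ n"
      by (rule tendsto_lowerbound) (use k in auto)
    then show ?thesis
      by (simp add: power_mult_distrib power_mult[symmetric] mult_ac)
  qed
  moreover have "(\<lambda>n. 2 * C\<^sup>2 * (c * r\<^sup>2) ^ n) \<longlonglongrightarrow> 0"
  proof -
    have "r\<^sup>2 < (1 / sqrt c)\<^sup>2" using r r0 by (intro power_strict_mono) auto
    then have "c * r\<^sup>2 < 1" using c by (simp add: power_divide field_simps)
    then show ?thesis
      using c by (intro tendsto_mult_right_zero LIMSEQ_power_zero) simp
  qed
  ultimately have "(1::real) \<le> 0"
    by (intro tendsto_lowerbound[of "\<lambda>n. 2 * C\<^sup>2 * (c * r\<^sup>2) ^ n" 0 sequentially 1]) auto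
  then show False by simp
qed

theorem theorem3p4:
  fixes \<phi> :: "complex \<Rightarrow> complex"
  assumes "\<phi> holomorphic_on RHP"
    and "\<phi> ` RHP \<subseteq> RHP"
    and "H2_bounded_operator (composition_operator \<phi>)"
  shows "H2_spectral_radius (composition_operator \<phi>) = H2_operator_norm (composition_operator \<phi>)"
proof -
  let ?T = "composition_operator \<phi>"
  let ?N = "H2_operator_norm ?T"
  note phi = assms(1,2) and T = assms(3)
  obtain c where c: "c > 0" and ge: "\<And>z. z \<in> RHP \<Longrightarrow> c * Re z \<le> Re (\<phi> z)"
    and inf: "\<And>\<epsilon>. \<epsilon> > 0 \<Longrightarrow> \<exists>z\<in>RHP. Re (\<phi> z) < (c + \<epsilon>) * Re z"
    using composition_operator_lower_bound[OF T phi(2)] by blast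
  have N_le: "?N \<le> 1 / sqrt c"
    using H2_norm_composition_operator_le[OF phi c ge] c
    by (intro H2_operator_norm_le) auto
  have spec_le: "cmod \<mu> \<le> ?N" if "\<mu> \<in> H2_spectrum ?T" for \<mu>
    using spectrum_composition_operator_bound[OF phi(2) T _ H2_operator_norm_nonneg[OF T] H2_operator_norm_bound[OF T]] that
    by (meson not_le)
  have large: "\<exists>\<mu>\<in>H2_spectrum ?T. cmod \<mu> > s" if "s > 0" "s < 1 / sqrt c" for s
    by (rule spectrum_composition_operator_large[OF phi T c ge inf that])
  \<comment> \<open>The real supremum in the spectral radius needs a bounded, nonempty spectrum.
    Nonemptiness comes from \<open>large\<close>, not from Liouville's theorem.\<close>
  have bdd: "bdd_above (cmod ` H2_spectrum ?T)"
    using spec_le by (intro bdd_aboveI2)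
  have "0 < 1 / sqrt c" using c by simp
  then obtain s0 where "s0 > 0" "s0 < 1 / sqrt c" using dense by blast
  then have ne: "H2_spectrum ?T \<noteq> {}" using large by blast
  have "H2_spectral_radius ?T \<le> ?N"
    unfolding H2_spectral_radius_def by (rule cSUP_least[OF ne spec_le])
  moreover have "1 / sqrt c \<le> H2_spectral_radius ?T"
  proof (rule dense_le_bounded[OF \<open>0 < 1 / sqrt c\<close>])
    fix s assume "0 < s" "s < 1 / sqrt c"
    then obtain \<mu> where "\<mu> \<in> H2_spectrum ?T" "cmod \<mu> > s" using large by blast
    then show "s \<le> H2_spectral_radius ?T"
      unfolding H2_spectral_radius_def using cSUP_upper[OF _ bdd] by fastforce
  qed
  ultimately show ?thesis using N_le by linarith
qed

end
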